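(* Let $m,k\in\mathbb{N}$ with $k\ge 2$, and let $T\subseteq\Sigma_m^*$ be a finite tree with $k$ terminal nodes $\tau_0,\dots,\tau_{k-1}$, with induced length function $\ell=\ell_T$, generated self-similar fractal tree $F_T$, and measure $\mu_\ell$ on $\Sigma_k^\infty$ derived from $\ell$. Then for every $x\in F_T$, \[ \dim(x)=\mathrm{sdim}(F_T)\cdot\dim^{\mu_\ell}(y)\qquad\text{and}\qquad \mathrm{Dim}(x)=\mathrm{sdim}(F_T)\cdot\mathrm{Dim}^{\mu_\ell}(y), \] where $y\in\Sigma_k^\infty$ is the coding sequence of $x$.
   Context: Logarithms are to base 2. $\Sigma_m=\{0,1,\dots,m-1\}$; $\Sigma_m^*$ is the set of finite strings and $\Sigma_m^\infty$ the set of infinite sequences over $\Sigma_m$; $|\sigma|$ is the number of symbols of $\sigma$; $x{\upharpoonright}n$ is the initial segment of $x$ of length $n$, and $x{\upharpoonright}[a,b)$ is the string $x(a)x(a+1)\cdots x(b-1)$. Trees. A tree is a subset of $\Sigma_m^*$ closed under taking initial segments. A finite tree $T$ is specified by a finite prefix-free set $S\subseteq\Sigma_m^*$ (no element is a proper initial segment of another), $T$ being the set of all initial segments of elements of $S$; the elements of $S$ are the terminal nodes of $T$. $T^*$ is the infinite tree of all initial segments of finite concatenations of terminal nodes of $T$, and the self-similar fractal tree generated by $T$ is $F_T=[T^*]$, the set of $x\in\Sigma_m^\infty$ all of whose finite initial segments lie in $T^*$. The similarity dimension $\mathrm{sdim}(F_T)$ is the unique real $\beta$ satisfying $\sum_{i=0}^{k-1}m^{-\beta|\tau_i|}=1$.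 Length function and measure. The length function induced by $T$ is $\ell_T:\Sigma_k\to\mathbb{N}$, $\ell_T(i)=|\tau_i|$. For a length function $\ell:\Sigma_k\to\mathbb{N}$, the channel capacity is the unique real $\alpha\ge0$ with $\sum_{i=0}^{k-1}2^{-\alpha\ell(i)}=1$. With $r=2^{-\alpha}$, the measure $\mu_\ell$ derived from $\ell$ is the Bernoulli (product) probability measure on $\Sigma_k^\infty$ with $\mu_\ell(i)=r^{\ell(i)}$ for $i\in\Sigma_k$. For a string $\sigma$, $\mu(\sigma)$ denotes the measure of the cylinder set of all infinite sequences extending $\sigma$. Coding sequence. For each $x\in F_T$ there is a unique sequence $0=n_0<n_1<n_2<\cdots$ such that $x{\upharpoonright}[n_i,n_{i+1})$ is a terminal node of $T$ for every $i\in\mathbb{N}$. The coding sequence of $x$ is the $y\in\Sigma_k^\infty$ with $y(i)=j$, where $j$ is the index with $x{\upharpoonright}[n_i,n_{i+1})=\tau_j$. Complexity and dimension. For any finite alphabet $\Sigma_p$, $K(\tau)$ denotes the prefix-free Kolmogorov complexity of $\tau\in\Sigma_p^*$: $K(\tau)=\min\{|\sigma|:U(\sigma)=\tau\}$, where $(M_e)_{e\in\mathbb{N}}$ is an effective enumeration of all prefix-free Turing machines (machines whose domain is a prefix-free set) from $\Sigma_2^*$ to $\Sigma_p^*$, and $U$ is the universal prefix-free machine $U(1^e0\sigma)=M_e(\sigma)$. For $x\in\Sigma_m^\infty$, \[\dim(x)=\liminf_{n\to\infty}\frac{K(x{\upharpoonright}n)}{n\log(m)},\qquad \mathrm{Dim}(x)=\limsup_{n\to\infty}\frac{K(x{\upharpoonright}n)}{n\log(m)}\]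 (effective dimension and effective strong dimension). For a computable measure $\mu$ on $\Sigma_k^\infty$ and $y\in\Sigma_k^\infty$, \[\dim^{\mu}(y)=\liminf_{n\to\infty}\frac{K(y{\upharpoonright}n)}{-\log\mu(y{\upharpoonright}n)},\qquad \mathrm{Dim}^{\mu}(y)=\limsup_{n\to\infty}\frac{K(y{\upharpoonright}n)}{-\log\mu(y{\upharpoonright}n)}.\] *)

theory Defs
  imports "HOL-Probability.Probability" "HOL-Library.Sublist"
begin

section \<open>Strings and sequences\<close>

text \<open>The alphabet with \<open>m\<close> symbols is \<open>{..<m}\<close>; finite strings are lists and infinite
  sequences are functions on \<open>nat\<close>.\<close>

definition words :: "nat \<Rightarrow> nat list set" where
  "words m = lists {..<m}"

definition seqs :: "nat \<Rightarrow> (nat \<Rightarrow> nat) set" where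
  "seqs m = UNIV \<rightarrow> {..<m}"

definition segment :: "(nat \<Rightarrow> 'a) \<Rightarrow> nat \<Rightarrow> nat \<Rightarrow> 'a list" where
  "segment x a b = map x [a..<b]"

abbreviation initial :: "(nat \<Rightarrow> 'a) \<Rightarrow> nat \<Rightarrow> 'a list" where
  "initial x n \<equiv> segment x 0 n"

definition prefix_free :: "'a list set \<Rightarrow> bool" where
  "prefix_free S \<longleftrightarrow> (\<forall>\<sigma>\<in>S. \<forall>\<rho>\<in>S. \<not> strict_prefix \<sigma> \<rho>)"

section \<open>Trees and self-similar fractal trees\<close>

definition initial_segments :: "'a list set \<Rightarrow> 'a list set" where
  "initial_segments S = {\<rho>. \<exists>\<sigma>\<in>S. prefix \<rho> \<sigma>}"

definition finite_tree :: "nat \<Rightarrow> nat list set \<Rightarrow> bool" where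
  "finite_tree m T \<longleftrightarrow>
     (\<exists>S. finite S \<and> S \<subseteq> words m \<and> prefix_free S \<and> T = initial_segments S)"

text \<open>The specifying set of a finite tree is recovered as its set of maximal nodes; see
  \<open>terminal_nodes_initial_segments\<close>.\<close>

definition terminal_nodes :: "'a list set \<Rightarrow> 'a list set" where
  "terminal_nodes T = {\<sigma>\<in>T. \<forall>\<rho>\<in>T. \<not> strict_prefix \<sigma> \<rho>}"

lemma terminal_nodes_initial_segments:
  assumes "prefix_free S"
  shows "terminal_nodes (initial_segments S) = S"
proof (intro equalityI subsetI)
  fix \<sigma> assume "\<sigma> \<in> terminal_nodes (initial_segments S)"
  then show "\<sigma> \<in> S"
    unfolding terminal_nodes_def initial_segments_def strict_prefix_def by blast
next
  fix \<sigma> assume \<sigma>: "\<sigma> \<in> S"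
  have "\<not> strict_prefix \<sigma> \<rho>" if "\<rho> \<in> initial_segments S" for \<rho>
  proof
    assume less: "strict_prefix \<sigma> \<rho>"
    from that obtain \<sigma>' where "\<sigma>' \<in> S" "prefix \<rho> \<sigma>'"
      unfolding initial_segments_def by blast
    with less have "strict_prefix \<sigma> \<sigma>'"
      by (simp add: prefix_order.less_le_trans)
    with assms \<sigma> \<open>\<sigma>' \<in> S\<close> show False
      unfolding prefix_free_def by blast
  qed
  moreover have "\<sigma> \<in> initial_segments S"
    using \<sigma> unfolding initial_segments_def by blast
  ultimately show "\<sigma> \<in> terminal_nodes (initial_segments S)"
    unfolding terminal_nodes_def by blast
qed

definition tree_star :: "'a list set \<Rightarrow> 'a list set" where
  "tree_star T = initial_segments (concat ` lists (terminal_nodes T))"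

definition fractal_tree :: "nat \<Rightarrow> nat list set \<Rightarrow> (nat \<Rightarrow> nat) set" where
  "fractal_tree m T = {x \<in> seqs m. \<forall>n. initial x n \<in> tree_star T}"

definition sdim :: "nat \<Rightarrow> nat list set \<Rightarrow> real" where
  "sdim m T = (THE \<beta>. (\<Sum>\<tau>\<in>terminal_nodes T. real m powr (- \<beta> * real (length \<tau>))) = 1)"

section \<open>Coding sequences\<close>

definition cut_points :: "'a list set \<Rightarrow> (nat \<Rightarrow> 'a) \<Rightarrow> nat \<Rightarrow> nat" where
  "cut_points T x = (THE n. n 0 = 0 \<and> strict_mono n \<and>
     (\<forall>i. segment x (n i) (n (Suc i)) \<in> terminal_nodes T))"

text \<open>The enumeration of the terminal nodes of \<open>T\<close> is \<open>\<tau> 0, \<dots>, \<tau> (k - 1)\<close>.\<close>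

definition coding_sequence ::
    "nat list set \<Rightarrow> nat \<Rightarrow> (nat \<Rightarrow> nat list) \<Rightarrow> (nat \<Rightarrow> nat) \<Rightarrow> nat \<Rightarrow> nat" where
  "coding_sequence T k \<tau> x i =
     (THE j. j < k \<and> segment x (cut_points T x i) (cut_points T x (Suc i)) = \<tau> j)"

section \<open>The measure derived from a length function\<close>

definition channel_capacity :: "nat \<Rightarrow> (nat \<Rightarrow> nat) \<Rightarrow> real" where
  "channel_capacity k len =
     (THE \<alpha>. \<alpha> \<ge> 0 \<and> (\<Sum>i<k. 2 powr (- \<alpha> * real (len i))) = 1)"

definition length_measure :: "nat \<Rightarrow> (nat \<Rightarrow> nat) \<Rightarrow> (nat \<Rightarrow> nat) measure" where
  "length_measure k len =
     (let r = 2 powr (- channel_capacity k len)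
      in Pi\<^sub>M UNIV (\<lambda>_. point_measure {..<k} (\<lambda>i. ennreal (r ^ len i))))"

definition cylinder_measure :: "(nat \<Rightarrow> 'a) measure \<Rightarrow> 'a list \<Rightarrow> real" where
  "cylinder_measure \<mu> \<sigma> = measure \<mu> {z \<in> space \<mu>. initial z (length \<sigma>) = \<sigma>}"

section \<open>Turing machines\<close>

text \<open>Machines have a two-way infinite read-write tape, initially holding the binary input, and a
  write-only output tape to which each step appends at most one symbol. On the read-write tape the
  bits are \<open>0\<close> and \<open>1\<close>, and \<open>2\<close> is the blank. A machine halts when no transition applies.\<close>

datatype direction = MoveLeft | Stay | MoveRight

record tm =
  tm_states :: "nat set"
  tm_symbols :: "nat set"
  tm_start :: nat
  tm_trans :: "nat \<Rightarrow> nat \<Rightarrow> (nat \<times> nat \<times> direction \<times> nat option) option"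

definition tm_wf :: "nat \<Rightarrow> tm \<Rightarrow> bool" where
  "tm_wf p M \<longleftrightarrow>
     finite (tm_states M) \<and> tm_start M \<in> tm_states M \<and>
     finite (tm_symbols M) \<and> {0, 1, 2} \<subseteq> tm_symbols M \<and>
     (\<forall>q\<in>tm_states M. \<forall>a\<in>tm_symbols M. \<forall>q' b d w. tm_trans M q a = Some (q', b, d, w) \<longrightarrow>
        q' \<in> tm_states M \<and> b \<in> tm_symbols M \<and> set_option w \<subseteq> {..<p})"

text \<open>A configuration consists of state, tape contents, head position and output so far.\<close>

type_synonym tm_config = "nat \<times> (int \<Rightarrow> nat) \<times> int \<times> nat list"

definition tm_init :: "tm \<Rightarrow> nat list \<Rightarrow> tm_config" where
  "tm_init M \<sigma> =
     (tm_start M, \<lambda>i. if 0 \<le> i \<and> i < int (length \<sigma>) then \<sigma> ! nat i else 2, 0, [])"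

fun move_head :: "direction \<Rightarrow> int \<Rightarrow> int" where
  "move_head MoveLeft h = h - 1"
| "move_head Stay h = h"
| "move_head MoveRight h = h + 1"

inductive tm_step :: "tm \<Rightarrow> tm_config \<Rightarrow> tm_config \<Rightarrow> bool" for M where
  "tm_trans M q (t h) = Some (q', b, d, w) \<Longrightarrow>
     tm_step M (q, t, h, out)
       (q', t(h := b), move_head d h, out @ (case w of None \<Rightarrow> [] | Some c \<Rightarrow> [c]))"

definition tm_outputs :: "tm \<Rightarrow> nat list \<Rightarrow> nat list \<Rightarrow> bool" where
  "tm_outputs M \<sigma> \<tau> \<longleftrightarrow>
     (\<exists>q t h. (tm_step M)\<^sup>*\<^sup>* (tm_init M \<sigma>) (q, t, h, \<tau>) \<and> tm_trans M q (t h) = None)"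

text \<open>A partial function from binary strings to strings over \<open>{..<p}\<close> is represented as a map that
  is undefined outside \<open>words 2\<close>.\<close>

definition tm_computable :: "nat \<Rightarrow> (nat list \<rightharpoonup> nat list) \<Rightarrow> bool" where
  "tm_computable p f \<longleftrightarrow>
     (\<exists>M. tm_wf p M \<and> (\<forall>\<sigma> \<tau>. f \<sigma> = Some \<tau> \<longleftrightarrow> \<sigma> \<in> words 2 \<and> tm_outputs M \<sigma> \<tau>))"

definition prefix_free_machine :: "nat \<Rightarrow> (nat list \<rightharpoonup> nat list) \<Rightarrow> bool" where
  "prefix_free_machine p f \<longleftrightarrow> tm_computable p f \<and> prefix_free (dom f)"

section \<open>Prefix-free Kolmogorov complexity\<close>

definition universal :: "(nat \<Rightarrow> nat list \<rightharpoonup> nat list) \<Rightarrow> nat list \<rightharpoonup> nat list" where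
  "universal M \<rho> = (case dropWhile (\<lambda>b. b = 1) \<rho> of
       [] \<Rightarrow> None
     | b # \<sigma> \<Rightarrow> if b = 0 then M (length (takeWhile (\<lambda>b. b = 1) \<rho>)) \<sigma> else None)"

lemma universal_code: "universal M (replicate e 1 @ 0 # \<sigma>) = M e \<sigma>"
  by (simp add: universal_def dropWhile_append takeWhile_append)

lemma universal_eq_None:
  assumes "\<nexists>e \<sigma>. \<rho> = replicate e 1 @ 0 # \<sigma>"
  shows "universal M \<rho> = None"
proof (cases "dropWhile (\<lambda>b. b = 1) \<rho>")
  case Nil
  then show ?thesis unfolding universal_def Nil by simp
next
  case (Cons b \<sigma>)
  have "takeWhile (\<lambda>b. b = 1) \<rho> = replicate (length (takeWhile (\<lambda>b. b = 1) \<rho>)) 1"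
    by (metis (mono_tags, lifting) replicate_length_same set_takeWhileD)
  with Cons have eq: "\<rho> = replicate (length (takeWhile (\<lambda>b. b = 1) \<rho>)) 1 @ b # \<sigma>"
    by (metis takeWhile_dropWhile_id)
  have "b \<noteq> 0"
  proof
    assume "b = 0"
    with eq have "\<exists>e \<sigma>. \<rho> = replicate e 1 @ 0 # \<sigma>" by metis
    with assms show False by contradiction
  qed
  then show ?thesis unfolding universal_def Cons by simp
qed

text \<open>An enumeration of all prefix-free machines is effective if \<open>M e \<sigma>\<close> is partial computable in
  \<open>e\<close> and \<open>\<sigma>\<close> jointly, the pair being presented to a Turing machine as \<open>1\<^sup>e 0 \<sigma>\<close>.\<close>

definition effective_enumeration :: "nat \<Rightarrow> (nat \<Rightarrow> nat list \<rightharpoonup> nat list) \<Rightarrow> bool" where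
  "effective_enumeration p M \<longleftrightarrow>
     range M = {f. prefix_free_machine p f} \<and> tm_computable p (universal M)"

definition complexity :: "(nat \<Rightarrow> nat list \<rightharpoonup> nat list) \<Rightarrow> nat list \<Rightarrow> nat" where
  "complexity M \<tau> = (LEAST n. \<exists>\<sigma>. length \<sigma> = n \<and> universal M \<sigma> = Some \<tau>)"

section \<open>Effective dimensions\<close>

text \<open>Below, \<open>M\<close> is the enumeration of prefix-free machines with output alphabet that of the
  sequence. Limits are taken in \<open>ereal\<close>; the value of the quotient at \<open>n = 0\<close> is immaterial.\<close>

definition eff_dim :: "(nat \<Rightarrow> nat list \<rightharpoonup> nat list) \<Rightarrow> nat \<Rightarrow> (nat \<Rightarrow> nat) \<Rightarrow> ereal" where
  "eff_dim M m x =
     liminf (\<lambda>n. ereal (real (complexity M (initial x n)) / (real n * log 2 (real m))))"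

definition eff_Dim :: "(nat \<Rightarrow> nat list \<rightharpoonup> nat list) \<Rightarrow> nat \<Rightarrow> (nat \<Rightarrow> nat) \<Rightarrow> ereal" where
  "eff_Dim M m x =
     limsup (\<lambda>n. ereal (real (complexity M (initial x n)) / (real n * log 2 (real m))))"

definition eff_dim_measure ::
    "(nat \<Rightarrow> nat list \<rightharpoonup> nat list) \<Rightarrow> (nat \<Rightarrow> nat) measure \<Rightarrow> (nat \<Rightarrow> nat) \<Rightarrow> ereal" where
  "eff_dim_measure M \<mu> y =
     liminf (\<lambda>n. ereal (real (complexity M (initial y n)) /
                         (- log 2 (cylinder_measure \<mu> (initial y n)))))"

definition eff_Dim_measure ::
    "(nat \<Rightarrow> nat list \<rightharpoonup> nat list) \<Rightarrow> (nat \<Rightarrow> nat) measure \<Rightarrow> (nat \<Rightarrow> nat) \<Rightarrow> ereal" where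
  "eff_Dim_measure M \<mu> y =
     limsup (\<lambda>n. ereal (real (complexity M (initial y n)) /
                         (- log 2 (cylinder_measure \<mu> (initial y n)))))"

end

theory Submission
  imports Defs
begin

text \<open>Let \<open>n i\<close> be the cut points of \<open>x\<close>, so that \<open>x\<restriction>n i\<close> is the concatenation of the terminal
  nodes coded by \<open>y\<restriction>i\<close>. Three facts give the theorem.

  The strings \<open>x\<restriction>n i\<close> and \<open>y\<restriction>i\<close> have the same complexity up to a constant, and the same holds for
  \<open>x\<restriction>r\<close> with \<open>r\<close> at bounded distance from \<open>n i\<close>. Both translations are made by transducers with
  finitely many states. A decoder walks down the tree and emits the index of each terminal node that
  it reaches. An encoder replaces every index by its node but withholds the last \<open>d\<close> symbols, so
  that one of finitely many values of \<open>d\<close> turns \<open>y\<restriction>i\<close> into \<open>x\<restriction>r\<close>. A transducer can read the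
  write-only output of a Turing machine while it is being produced, and it does not change the
  domain; so composing it with the universal prefix-free machine gives again a prefix-free machine
  (\<open>prefix_free_machine_transduce\<close>), whose index in the enumeration bounds the loss in complexity
  (\<open>complexity_transduce_le\<close>).

  With \<open>\<alpha>\<close> the channel capacity, \<open>-log \<mu>(y\<restriction>i) = \<alpha> * n i\<close>
  (\<open>cylinder_measure_length_measure\<close>). Moreover \<open>\<alpha> = sdim * log m\<close>, because
  \<open>m powr (-\<beta> l) = 2 powr (-\<beta> log m * l)\<close> makes the two defining equations the same
  (\<open>sdim_eq_capacity\<close>). Hence \<open>sdim\<close> times the quotient defining the dimension of \<open>y\<close> is
  \<open>K(y\<restriction>i) / (n i * log m)\<close>.

  The gaps between cut points are bounded. So \<open>K(x\<restriction>r) / (r log m)\<close> and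
  \<open>K(y\<restriction>i) / (n i * log m)\<close>, for \<open>n i\<close> next to \<open>r\<close>, differ by a factor tending to one and a
  summand tending to zero, and their limits inferior and superior agree
  (\<open>ratio_limits_along_cuts\<close>).\<close>

section \<open>Post-composition of Turing machines with finite transducers\<close>

fun transduce :: "('s \<Rightarrow> 'a \<Rightarrow> 's) \<Rightarrow> ('s \<Rightarrow> 'a \<Rightarrow> 'b list) \<Rightarrow> 's \<Rightarrow> 'a list \<Rightarrow> 'b list" where
  "transduce \<delta> w s [] = []"
| "transduce \<delta> w s (c # cs) = w s c @ transduce \<delta> w (\<delta> s c) cs"

lemma transduce_append:
  "transduce \<delta> w s (xs @ ys) = transduce \<delta> w s xs @ transduce \<delta> w (foldl \<delta> s xs) ys"
  by (induction xs arbitrary: s) auto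

text \<open>The set \<open>Q\<close> of states matters only through its finiteness: the transition functions are total, and
  on input over \<open>{..<p}\<close> the run stays in \<open>Q\<close>.\<close>

definition transducer ::
    "nat \<Rightarrow> nat \<Rightarrow> ('s \<Rightarrow> nat \<Rightarrow> 's) \<Rightarrow> ('s \<Rightarrow> nat \<Rightarrow> nat list) \<Rightarrow> 's \<Rightarrow> 's set \<Rightarrow> bool" where
  "transducer p p' \<delta> w s0 Q \<longleftrightarrow> finite Q \<and> s0 \<in> Q \<and>
     (\<forall>s\<in>Q. \<forall>c<p. \<delta> s c \<in> Q \<and> w s c \<in> words p')"

text \<open>The machine for a composition can append only one symbol per step, so it keeps in its state the
  part of the current block \<open>w s c\<close> that it still has to write.\<close>

definition pending :: "nat \<Rightarrow> ('s \<Rightarrow> nat \<Rightarrow> nat list) \<Rightarrow> 's set \<Rightarrow> nat list set" where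
  "pending p w Q = insert [] (\<Union>s\<in>Q. \<Union>c<p. set (suffixes (w s c)))"

text \<open>A state encodes a state of \<open>M\<close>, a state of the transducer and the pending output. While output is
  pending the machine only writes; otherwise it makes the step of \<open>M\<close>, and a symbol \<open>c\<close> that \<open>M\<close>
  would write is fed to the transducer instead.\<close>

definition transducer_tm ::
    "nat \<Rightarrow> ('s::countable \<Rightarrow> nat \<Rightarrow> 's) \<Rightarrow> ('s \<Rightarrow> nat \<Rightarrow> nat list) \<Rightarrow> 's \<Rightarrow> 's set \<Rightarrow> tm \<Rightarrow> tm" where
  "transducer_tm p \<delta> w s0 Q M =
     \<lparr>tm_states = to_nat ` (tm_states M \<times> Q \<times> pending p w Q),
      tm_symbols = tm_symbols M,
      tm_start = to_nat (tm_start M, s0, [] :: nat list),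
      tm_trans = (\<lambda>N a. case from_nat N of
          (q, s, e # v) \<Rightarrow> Some (to_nat (q, s, v), a, Stay, Some e)
        | (q, s, []) \<Rightarrow>
           (case tm_trans M q a of
              None \<Rightarrow> None
            | Some (q', b, d, None) \<Rightarrow> Some (to_nat (q', s, [] :: nat list), b, d, None)
            | Some (q', b, d, Some c) \<Rightarrow> Some (to_nat (q', \<delta> s c, w s c), b, d, None)))\<rparr>"

lemma trans_transducer_tm:
  "tm_trans (transducer_tm p \<delta> w s0 Q M) (to_nat (q, s, e # v)) a =
     Some (to_nat (q, s, v), a, Stay, Some e)"
  "tm_trans M q a = None \<Longrightarrow>
     tm_trans (transducer_tm p \<delta> w s0 Q M) (to_nat (q, s, [] :: nat list)) a = None"
  "tm_trans M q a = Some (q', b, d, None) \<Longrightarrow>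
     tm_trans (transducer_tm p \<delta> w s0 Q M) (to_nat (q, s, [] :: nat list)) a =
       Some (to_nat (q', s, [] :: nat list), b, d, None)"
  "tm_trans M q a = Some (q', b, d, Some c) \<Longrightarrow>
     tm_trans (transducer_tm p \<delta> w s0 Q M) (to_nat (q, s, [] :: nat list)) a =
       Some (to_nat (q', \<delta> s c, w s c), b, d, None)"
  by (simp_all add: transducer_tm_def)

lemma tm_init_transducer_tm:
  assumes "tm_init M \<sigma> = (q, t, h, out)"
  shows "tm_init (transducer_tm p \<delta> w s0 Q M) \<sigma> = (to_nat (q, s0, [] :: nat list), t, h, out)"
  using assms by (auto simp: tm_init_def transducer_tm_def)

lemma tm_wf_transducer_tm:
  assumes wf: "tm_wf p M" and tr: "transducer p p' \<delta> w s0 Q"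
  shows "tm_wf p' (transducer_tm p \<delta> w s0 Q M)"
proof -
  let ?N = "transducer_tm p \<delta> w s0 Q M"
  have fin: "finite (pending p w Q)"
    using tr by (auto simp: pending_def transducer_def)
  have step: "q' \<in> tm_states ?N \<and> b \<in> tm_symbols ?N \<and> set_option e \<subseteq> {..<p'}"
    if q: "q \<in> tm_states ?N" and a: "a \<in> tm_symbols ?N"
      and t: "tm_trans ?N q a = Some (q', b, d, e)" for q a q' b d e
  proof -
    from q obtain r s v where r: "q = to_nat (r, s, v)" "r \<in> tm_states M" "s \<in> Q" "v \<in> pending p w Q"
      by (auto simp: transducer_tm_def)
    have a': "a \<in> tm_symbols M" using a by (simp add: transducer_tm_def)
    show ?thesis
    proof (cases v)
      case (Cons x xs)
      have "x < p' \<and> xs \<in> pending p w Q"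
      proof -
        from r(4) Cons obtain s' c where sc: "s' \<in> Q" "c < p" "suffix (x # xs) (w s' c)"
          by (auto simp: pending_def)
        then have "w s' c \<in> words p'" using tr by (auto simp: transducer_def)
        then have "x < p'"
          using set_mono_suffix[OF sc(3)] by (auto simp: words_def)
        moreover have "suffix xs (w s' c)"
          by (rule suffix_ConsD[OF sc(3)])
        ultimately show ?thesis using sc by (auto simp: pending_def)
      qed
      moreover have "q' = to_nat (r, s, xs)" "b = a" "e = Some x"
        using t r(1) Cons by (simp_all add: trans_transducer_tm)
      ultimately show ?thesis using r(2,3) a by (simp add: transducer_tm_def)
    next
      case Nil
      show ?thesis
      proof (cases "tm_trans M r a")
        case None
        then show ?thesis using t r Nil by (simp add: trans_transducer_tm)
      next
        case trans: (Some z)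
        obtain r' b' d' e' where z: "z = (r', b', d', e')" by (cases z)
        with trans r(2) a' wf have M: "r' \<in> tm_states M" "b' \<in> tm_symbols M" "set_option e' \<subseteq> {..<p}"
          unfolding tm_wf_def by blast+
        show ?thesis
        proof (cases e')
          case None
          have "q' = to_nat (r', s, [] :: nat list)" "b = b'" "e = None"
            using t r(1) Nil trans z None by (simp_all add: trans_transducer_tm)
          then show ?thesis using M r(3) by (simp add: transducer_tm_def pending_def)
        next
          case (Some c)
          with M have c: "c < p" by auto
          then have "\<delta> s c \<in> Q" "w s c \<in> pending p w Q"
            using r(3) tr by (auto simp: pending_def transducer_def)
          moreover have "q' = to_nat (r', \<delta> s c, w s c)" "b = b'" "e = None"
            using t r(1) Nil trans z Some by (simp_all add: trans_transducer_tm)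
          ultimately show ?thesis using M by (simp add: transducer_tm_def)
        qed
      qed
    qed
  qed
  have "finite (tm_states ?N)" "tm_start ?N \<in> tm_states ?N" "finite (tm_symbols ?N)"
      "{0, 1, 2} \<subseteq> tm_symbols ?N"
    using wf tr fin by (auto simp: transducer_tm_def transducer_def tm_wf_def pending_def)
  with step show ?thesis unfolding tm_wf_def by blast
qed

lemma tm_stepI:
  assumes "tm_trans M q (t h) = Some (q', b, d, e)"
    and "D = (q', t(h := b), move_head d h, out @ (case e of None \<Rightarrow> [] | Some c \<Rightarrow> [c]))"
  shows "tm_step M (q, t, h, out) D"
  using tm_step.intros[of M q t h, OF assms(1)] assms(2) by simp

text \<open>Writing pending output leaves state, tape and head of the simulated machine alone.\<close>

lemma transducer_tm_flush:
  fixes q :: nat and s :: "'s::countable"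
  shows "(tm_step (transducer_tm p (\<delta> :: 's \<Rightarrow> nat \<Rightarrow> 's) w s0 Q M))\<^sup>*\<^sup>*
     (to_nat (q, s, v), t, h, out) (to_nat (q, s, [] :: nat list), t, h, out @ v)"
proof (induction v arbitrary: out)
  case (Cons e v)
  have "tm_step (transducer_tm p \<delta> w s0 Q M) (to_nat (q, s, e # v), t, h, out)
      (to_nat (q, s, v), t, h, out @ [e])"
    by (rule tm_stepI, rule trans_transducer_tm(1)) simp
  with Cons[of "out @ [e]"] show ?case by (simp add: converse_rtranclp_into_rtranclp)
qed simp

lemma transducer_tm_simulates:
  assumes "(tm_step M)\<^sup>*\<^sup>* (tm_init M \<sigma>) C"
  shows "case C of (q, t, h, out) \<Rightarrow>
    (tm_step (transducer_tm p \<delta> w s0 Q M))\<^sup>*\<^sup>* (tm_init (transducer_tm p \<delta> w s0 Q M) \<sigma>)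
      (to_nat (q, foldl \<delta> s0 out, [] :: nat list), t, h, transduce \<delta> w s0 out)"
  using assms
proof (induction rule: rtranclp_induct)
  case base
  show ?case by (auto simp: tm_init_def transducer_tm_def)
next
  case (step C D)
  let ?N = "transducer_tm p \<delta> w s0 Q M"
  from step(2) obtain q t h q' b d e out
    where C: "C = (q, t, h, out)" and M: "tm_trans M q (t h) = Some (q', b, d, e)"
      and D: "D = (q', t(h := b), move_head d h, out @ (case e of None \<Rightarrow> [] | Some c \<Rightarrow> [c]))"
    by (cases rule: tm_step.cases) auto
  note IH = step(3)[unfolded C prod.case]
  show ?case
  proof (cases e)
    case None
    have "tm_step ?N (to_nat (q, foldl \<delta> s0 out, [] :: nat list), t, h, transduce \<delta> w s0 out)
       (to_nat (q', foldl \<delta> s0 out, [] :: nat list), t(h := b), move_head d h, transduce \<delta> w s0 out)"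
      by (rule tm_stepI, rule trans_transducer_tm(3)[OF M[unfolded None]]) simp
    then show ?thesis using IH None D by (simp add: rtranclp.rtrancl_into_rtrancl)
  next
    case (Some c)
    let ?s = "foldl \<delta> s0 out"
    have "tm_step ?N (to_nat (q, ?s, [] :: nat list), t, h, transduce \<delta> w s0 out)
       (to_nat (q', \<delta> ?s c, w ?s c), t(h := b), move_head d h, transduce \<delta> w s0 out)"
      by (rule tm_stepI, rule trans_transducer_tm(4)[OF M[unfolded Some]]) simp
    from rtranclp_trans[OF rtranclp.rtrancl_into_rtrancl[OF IH this] transducer_tm_flush]
    show ?thesis using Some D by (simp add: transduce_append)
  qed
qed

text \<open>Conversely the composed machine does nothing else: every configuration that it reaches is that of
  a reachable configuration of \<open>M\<close>, up to output that is still pending. This is what excludes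
  additional halting computations.\<close>

lemma transducer_tm_simulated:
  assumes "(tm_step (transducer_tm p \<delta> w s0 Q M))\<^sup>*\<^sup>* (tm_init (transducer_tm p \<delta> w s0 Q M) \<sigma>) C"
  shows "\<exists>q t h out v out'. C = (to_nat (q, foldl \<delta> s0 out, v), t, h, out') \<and>
    (tm_step M)\<^sup>*\<^sup>* (tm_init M \<sigma>) (q, t, h, out) \<and> transduce \<delta> w s0 out = out' @ v"
  using assms
proof (induction rule: rtranclp_induct)
  case base
  obtain q t h out where i: "tm_init M \<sigma> = (q, t, h, out)" by (cases "tm_init M \<sigma>")
  then have "out = []" by (simp add: tm_init_def)
  show ?case
    by (rule exI[of _ q], rule exI[of _ t], rule exI[of _ h], rule exI[of _ "[]"],
        rule exI[of _ "[]"], rule exI[of _ "[]"])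
      (use tm_init_transducer_tm[OF i] i \<open>out = []\<close> in auto)
next
  case (step C D)
  let ?N = "transducer_tm p \<delta> w s0 Q M"
  from step(3) obtain q t h out v out'
    where C: "C = (to_nat (q, foldl \<delta> s0 out, v), t, h, out')"
      and reach: "(tm_step M)\<^sup>*\<^sup>* (tm_init M \<sigma>) (q, t, h, out)"
      and out: "transduce \<delta> w s0 out = out' @ v"
    by blast
  from step(2) obtain q' b d e
    where N: "tm_trans ?N (to_nat (q, foldl \<delta> s0 out, v)) (t h) = Some (q', b, d, e)"
      and D: "D = (q', t(h := b), move_head d h, out' @ (case e of None \<Rightarrow> [] | Some c \<Rightarrow> [c]))"
    unfolding C by (cases rule: tm_step.cases) auto
  show ?case
  proof (cases v)
    case (Cons x xs)
    with N have "q' = to_nat (q, foldl \<delta> s0 out, xs)" "b = t h" "d = Stay" "e = Some x"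
      by (simp_all add: trans_transducer_tm)
    then have "D = (to_nat (q, foldl \<delta> s0 out, xs), t, h, out' @ [x])" using D by simp
    moreover have "transduce \<delta> w s0 out = (out' @ [x]) @ xs" using out Cons by simp
    ultimately show ?thesis using reach by blast
  next
    case Nil
    obtain r b' d' e' where M: "tm_trans M q (t h) = Some (r, b', d', e')"
      using N Nil by (cases "tm_trans M q (t h)") (auto simp: trans_transducer_tm)
    from rtranclp.rtrancl_into_rtrancl[OF reach tm_step.intros[of M q t h, OF M]]
    have reach': "(tm_step M)\<^sup>*\<^sup>* (tm_init M \<sigma>)
       (r, t(h := b'), move_head d' h, out @ (case e' of None \<Rightarrow> [] | Some c \<Rightarrow> [c]))" .
    show ?thesis
    proof (cases e')
      case None
      with M N Nil have "q' = to_nat (r, foldl \<delta> s0 out, [] :: nat list)" "b = b'" "d = d'" "e = None"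
        by (simp_all add: trans_transducer_tm)
      then show ?thesis using D reach' out None Nil by auto
    next
      case (Some c)
      with M N Nil have "q' = to_nat (r, foldl \<delta> s0 (out @ [c]), w (foldl \<delta> s0 out) c)"
          "b = b'" "d = d'" "e = None"
        by (simp_all add: trans_transducer_tm)
      then have "D = (to_nat (r, foldl \<delta> s0 (out @ [c]), w (foldl \<delta> s0 out) c), t(h := b'), move_head d' h, out')"
        using D by simp
      moreover have "transduce \<delta> w s0 (out @ [c]) = out' @ w (foldl \<delta> s0 out) c"
        using out Nil by (simp add: transduce_append)
      moreover have "(tm_step M)\<^sup>*\<^sup>* (tm_init M \<sigma>) (r, t(h := b'), move_head d' h, out @ [c])"
        using reach' Some by simp
      ultimately show ?thesis by blast
    qed
  qed
qed

text \<open>The composed machine cannot halt with output pending, and without pending output it halts exactly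
  when \<open>M\<close> does.\<close>

lemma tm_outputs_transducer_tm:
  "tm_outputs (transducer_tm p \<delta> w s0 Q M) \<sigma> \<tau> \<longleftrightarrow>
     (\<exists>\<rho>. tm_outputs M \<sigma> \<rho> \<and> \<tau> = transduce \<delta> w s0 \<rho>)"
proof
  let ?N = "transducer_tm p \<delta> w s0 Q M"
  assume "tm_outputs ?N \<sigma> \<tau>"
  then obtain N t h where run: "(tm_step ?N)\<^sup>*\<^sup>* (tm_init ?N \<sigma>) (N, t, h, \<tau>)"
    and halt: "tm_trans ?N N (t h) = None"
    by (auto simp: tm_outputs_def)
  from transducer_tm_simulated[OF run] obtain q out v
    where N: "N = to_nat (q, foldl \<delta> s0 out, v)"
      and reach: "(tm_step M)\<^sup>*\<^sup>* (tm_init M \<sigma>) (q, t, h, out)"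
      and out: "transduce \<delta> w s0 out = \<tau> @ v"
    by auto
  have v: "v = []" using halt N by (cases v) (auto simp: trans_transducer_tm)
  have "tm_trans M q (t h) = None"
  proof (rule ccontr)
    assume "tm_trans M q (t h) \<noteq> None"
    then obtain r b d e where "tm_trans M q (t h) = Some (r, b, d, e)" by auto
    then show False using halt N v by (cases e) (auto simp: trans_transducer_tm)
  qed
  then show "\<exists>\<rho>. tm_outputs M \<sigma> \<rho> \<and> \<tau> = transduce \<delta> w s0 \<rho>"
    using reach out v by (auto simp: tm_outputs_def)
next
  let ?N = "transducer_tm p \<delta> w s0 Q M"
  assume "\<exists>\<rho>. tm_outputs M \<sigma> \<rho> \<and> \<tau> = transduce \<delta> w s0 \<rho>"
  then obtain \<rho> q t h where run: "(tm_step M)\<^sup>*\<^sup>* (tm_init M \<sigma>) (q, t, h, \<rho>)"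
    and halt: "tm_trans M q (t h) = None" and \<tau>: "\<tau> = transduce \<delta> w s0 \<rho>"
    by (auto simp: tm_outputs_def)
  show "tm_outputs ?N \<sigma> \<tau>"
    unfolding tm_outputs_def \<tau>
    using transducer_tm_simulates[OF run, of p \<delta> w s0 Q, unfolded prod.case]
      trans_transducer_tm(2)[OF halt] by blast
qed

lemma prefix_free_machine_transduce:
  fixes \<delta> :: "'s::countable \<Rightarrow> nat \<Rightarrow> 's"
  assumes f: "prefix_free_machine p f" and tr: "transducer p p' \<delta> w s0 Q"
  shows "prefix_free_machine p' (\<lambda>\<sigma>. map_option (transduce \<delta> w s0) (f \<sigma>))"
proof -
  from f obtain M where wf: "tm_wf p M"
    and M: "\<And>\<sigma> \<tau>. f \<sigma> = Some \<tau> \<longleftrightarrow> \<sigma> \<in> words 2 \<and> tm_outputs M \<sigma> \<tau>"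
    by (auto simp: prefix_free_machine_def tm_computable_def)
  have "map_option (transduce \<delta> w s0) (f \<sigma>) = Some \<tau> \<longleftrightarrow>
      \<sigma> \<in> words 2 \<and> tm_outputs (transducer_tm p \<delta> w s0 Q M) \<sigma> \<tau>" for \<sigma> \<tau>
    unfolding tm_outputs_transducer_tm using M by auto
  with tm_wf_transducer_tm[OF wf tr]
  have "tm_computable p' (\<lambda>\<sigma>. map_option (transduce \<delta> w s0) (f \<sigma>))"
    unfolding tm_computable_def by blast
  moreover have "dom (\<lambda>\<sigma>. map_option (transduce \<delta> w s0) (f \<sigma>)) = dom f" by auto
  ultimately show ?thesis using f by (simp add: prefix_free_machine_def)
qed

section \<open>Complexity\<close>

text \<open>A prefix relation between two codes \<open>1\<^sup>e 0 \<sigma>\<close> forces equal \<open>e\<close>, because the first \<open>0\<close> ends the unary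
  part; it then becomes a prefix relation in the domain of a single machine.\<close>

lemma prefix_free_machine_universal:
  assumes "effective_enumeration p M"
  shows "prefix_free_machine p (universal M)"
proof -
  have code: "\<exists>e \<sigma>. \<rho> = replicate e 1 @ 0 # \<sigma> \<and> \<sigma> \<in> dom (M e)" if \<rho>: "\<rho> \<in> dom (universal M)" for \<rho>
  proof -
    from \<rho> obtain e \<sigma> where e: "\<rho> = replicate e 1 @ 0 # \<sigma>"
      using universal_eq_None[of \<rho> M] by (metis domIff)
    with \<rho> have "\<sigma> \<in> dom (M e)" by (metis domIff universal_code)
    with e show ?thesis by blast
  qed
  have unary: "e = e' \<and> prefix \<sigma> \<sigma>'"
    if "prefix (replicate e 1 @ 0 # \<sigma>) (replicate e' 1 @ 0 # \<sigma>')" for e e' and \<sigma> \<sigma>' :: "nat list"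
    using that
  proof (induction e arbitrary: e')
    case 0 then show ?case by (cases e') auto
  next
    case (Suc e) then show ?case by (cases e') auto
  qed
  have "prefix_free (dom (universal M))"
    unfolding prefix_free_def
  proof (intro ballI notI)
    fix \<rho> \<rho>' assume *: "\<rho> \<in> dom (universal M)" "\<rho>' \<in> dom (universal M)" "strict_prefix \<rho> \<rho>'"
    from code[OF *(1)] code[OF *(2)] obtain e \<sigma> e' \<sigma>'
      where 1: "\<rho> = replicate e 1 @ 0 # \<sigma>" "\<sigma> \<in> dom (M e)"
        and 2: "\<rho>' = replicate e' 1 @ 0 # \<sigma>'" "\<sigma>' \<in> dom (M e')" by blast
    have "prefix \<rho> \<rho>'" using *(3) by (simp add: strict_prefix_def)
    with 1 2 have e: "e = e'" "prefix \<sigma> \<sigma>'" using unary by blast+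
    have "strict_prefix \<sigma> \<sigma>'" using *(3) 1(1) 2(1) e by (auto simp: strict_prefix_def)
    moreover have "prefix_free_machine p (M e)"
      using assms by (auto simp: effective_enumeration_def)
    ultimately show False using 1 2 e by (auto simp: prefix_free_machine_def prefix_free_def)
  qed
  then show ?thesis using assms by (simp add: prefix_free_machine_def effective_enumeration_def)
qed

text \<open>The constant is the length of the prefix \<open>1\<^sup>e 0\<close> that selects the composition of the universal
  machine with the transducer. The existence of a description is needed because \<open>complexity\<close> is a
  \<open>LEAST\<close> and says nothing about a string without one.\<close>

lemma complexity_transduce_le:
  fixes \<delta> :: "'s::countable \<Rightarrow> nat \<Rightarrow> 's"
  assumes M: "effective_enumeration p M" and N: "effective_enumeration p' N"
    and tr: "transducer p p' \<delta> w s0 Q"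
  shows "\<exists>C. \<forall>\<tau>. (\<exists>\<sigma>. universal M \<sigma> = Some \<tau>) \<longrightarrow>
           complexity N (transduce \<delta> w s0 \<tau>) \<le> complexity M \<tau> + C"
proof -
  have "prefix_free_machine p' (\<lambda>\<sigma>. map_option (transduce \<delta> w s0) (universal M \<sigma>))"
    by (rule prefix_free_machine_transduce[OF prefix_free_machine_universal[OF M] tr])
  then have "(\<lambda>\<sigma>. map_option (transduce \<delta> w s0) (universal M \<sigma>)) \<in> range N"
    using N by (simp add: effective_enumeration_def)
  then obtain e where e: "\<And>\<sigma>. N e \<sigma> = map_option (transduce \<delta> w s0) (universal M \<sigma>)"
    by (metis (no_types, lifting) imageE)
  have "complexity N (transduce \<delta> w s0 \<tau>) \<le> complexity M \<tau> + Suc e"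
    if "\<exists>\<sigma>. universal M \<sigma> = Some \<tau>" for \<tau>
  proof -
    from that have "\<exists>n \<sigma>. length \<sigma> = n \<and> universal M \<sigma> = Some \<tau>" by blast
    from LeastI_ex[OF this] obtain \<sigma>
      where \<sigma>: "length \<sigma> = complexity M \<tau>" "universal M \<sigma> = Some \<tau>"
      unfolding complexity_def by blast
    have "universal N (replicate e 1 @ 0 # \<sigma>) = Some (transduce \<delta> w s0 \<tau>)"
      unfolding universal_code e \<sigma>(2) by simp
    moreover have "length (replicate e 1 @ 0 # \<sigma>) = complexity M \<tau> + Suc e"
      using \<sigma>(1) by simp
    ultimately show ?thesis unfolding complexity_def by (blast intro: Least_le)
  qed
  then show ?thesis by blast
qed

text \<open>A machine that runs forever unless its input is empty. Feeding its single output symbol to a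
  one-state transducer yields any prescribed string; this gives every string a description.\<close>

lemma prefix_free_machine_single:
  "prefix_free_machine 1 [[] \<mapsto> [0]]"
proof -
  define M where "M = \<lparr>tm_states = {0, 1}, tm_symbols = {0, 1, 2}, tm_start = 0,
    tm_trans = (\<lambda>q a. if q = 0 then (if a = 2 then Some (1, 2, Stay, Some 0) else Some (0, a, Stay, None))
                      else None)\<rparr>"
  have wf: "tm_wf 1 M" by (auto simp: tm_wf_def M_def)
  have reach: "C = tm_init M \<sigma> \<or> \<sigma> = [] \<and> (\<exists>t. C = (1, t, 0, [0]))"
    if "(tm_step M)\<^sup>*\<^sup>* (tm_init M \<sigma>) C" "\<sigma> \<in> words 2" for \<sigma> C
    using that
  proof (induction rule: rtranclp_induct)
    case (step C D)
    from step(3)[OF step(4)] show ?case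
    proof
      assume C: "C = tm_init M \<sigma>"
      show ?thesis
      proof (cases \<sigma>)
        case Nil
        with step(2) C show ?thesis by (auto simp: tm_init_def M_def elim!: tm_step.cases)
      next
        case (Cons a as)
        then have "a < 2" using step(4) by (simp add: words_def)
        with step(2) C Cons show ?thesis
          by (auto simp: tm_init_def M_def elim!: tm_step.cases)
      qed
    next
      assume "\<sigma> = [] \<and> (\<exists>t. C = (1, t, 0, [0]))"
      with step(2) show ?thesis by (auto simp: M_def elim!: tm_step.cases)
    qed
  qed simp
  have "([[] \<mapsto> [0]] \<sigma> = Some \<tau>) = (\<sigma> \<in> words 2 \<and> tm_outputs M \<sigma> \<tau>)" for \<sigma> \<tau> :: "nat list"
  proof
    assume "[[] \<mapsto> [0]] \<sigma> = Some \<tau>"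
    then have \<sigma>: "\<sigma> = []" "\<tau> = [0]" by (auto split: if_splits)
    have "tm_step M (tm_init M []) (1, (\<lambda>i. 2)(0 := 2), 0, [0])"
      unfolding tm_init_def by (rule tm_stepI[where e = "Some 0" and d = Stay and b = 2]) (auto simp: M_def)
    then have "(tm_step M)\<^sup>*\<^sup>* (tm_init M []) (1, (\<lambda>i. 2)(0 := 2), 0, [0])" by simp
    moreover have "tm_trans M 1 a = None" for a by (simp add: M_def)
    ultimately have "tm_outputs M [] [0]" unfolding tm_outputs_def by blast
    then show "\<sigma> \<in> words 2 \<and> tm_outputs M \<sigma> \<tau>" using \<sigma> by (simp add: words_def)
  next
    assume *: "\<sigma> \<in> words 2 \<and> tm_outputs M \<sigma> \<tau>"
    then obtain q t h where run: "(tm_step M)\<^sup>*\<^sup>* (tm_init M \<sigma>) (q, t, h, \<tau>)"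
      and halt: "tm_trans M q (t h) = None" by (auto simp: tm_outputs_def)
    have "q \<noteq> 0" using halt by (auto simp: M_def split: if_splits)
    with reach[OF run] * show "[[] \<mapsto> [0]] \<sigma> = Some \<tau>"
      by (auto simp: tm_init_def M_def)
  qed
  with wf have "tm_computable 1 [[] \<mapsto> [0]]" unfolding tm_computable_def by blast
  then show ?thesis by (simp add: prefix_free_machine_def prefix_free_def)
qed

lemma describable:
  assumes M: "effective_enumeration p M" and \<tau>: "\<tau> \<in> words p"
  shows "\<exists>\<sigma>. universal M \<sigma> = Some \<tau>"
proof -
  let ?f = "\<lambda>\<sigma> :: nat list. map_option (transduce (\<lambda>_ _. ()) (\<lambda>_ _. \<tau>) ()) ([[] \<mapsto> [0 :: nat]] \<sigma>)"
  have "transducer 1 p (\<lambda>_ _. ()) (\<lambda>_ _. \<tau>) () UNIV"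
    using \<tau> by (simp add: transducer_def)
  from prefix_free_machine_transduce[OF prefix_free_machine_single this]
  have "?f \<in> range M" using M by (simp add: effective_enumeration_def)
  then obtain e where "?f = M e" by blast
  then have "M e [] = ?f []" by (rule fun_cong[OF sym])
  also have "\<dots> = Some \<tau>" by simp
  finally have "M e [] = Some \<tau>" .
  then show ?thesis using universal_code[of M e "[]"] by metis
qed

section \<open>Cutting a path of a fractal tree\<close>

lemma length_segment [simp]: "length (segment x a b) = b - a"
  by (simp add: segment_def)

lemma segment_append: "a \<le> b \<Longrightarrow> b \<le> c \<Longrightarrow> segment x a b @ segment x b c = segment x a c"
  using upt_add_eq_append[of a b "c - b"] by (simp add: segment_def flip: map_append)

lemma take_segment: "take l (segment x a b) = segment x a (min (a + l) b)"
  by (rule nth_equalityI) (auto simp: segment_def)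

lemma prefix_free_comparable:
  "prefix_free S \<Longrightarrow> u \<in> S \<Longrightarrow> v \<in> S \<Longrightarrow> prefix u w \<Longrightarrow> prefix v w \<Longrightarrow> u = v"
  unfolding prefix_free_def strict_prefix_def by (metis prefix_same_cases)

text \<open>The cuts are found one after the other. The invariant \<open>P a\<close> says that the path from position \<open>a\<close> on
  again lies in the infinite tree. It persists because, by prefix-freeness, every covering
  concatenation of a longer segment must begin with the same node.\<close>

lemma cuts_exist:
  assumes fin: "finite S" and pf: "prefix_free S" and ne: "[] \<notin> S"
    and x: "\<And>b. initial x b \<in> initial_segments (concat ` lists S)"
  shows "\<exists>n. n 0 = 0 \<and> strict_mono n \<and> (\<forall>i. segment x (n i) (n (Suc i)) \<in> S)"
proof -
  define P where "P a \<longleftrightarrow> (\<forall>b. segment x a b \<in> initial_segments (concat ` lists S))" for a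
  obtain L where L: "\<And>w. w \<in> S \<Longrightarrow> length w \<le> L"
    using finite_maxlen[OF fin] by (meson less_imp_le)
  have step: "\<exists>b. P b \<and> a < b \<and> segment x a b \<in> S" if a: "P a" for a
  proof -
    \<comment> \<open>The segment is longer than any node, so the first node of a covering concatenation fits in it.\<close>
    have "segment x a (a + Suc L) \<in> initial_segments (concat ` lists S)"
      using a unfolding P_def by blast
    then obtain ws where ws: "ws \<in> lists S" "prefix (segment x a (a + Suc L)) (concat ws)"
      unfolding initial_segments_def by blast
    have "ws \<noteq> []" using ws(2) by (auto dest: prefix_length_le)
    then obtain w ws' where w: "ws = w # ws'" by (cases ws) auto
    then have wS: "w \<in> S" using ws by simp
    have "prefix w (concat ws)" using w by simp
    then have "prefix w (segment x a (a + Suc L))"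
      by (rule prefix_length_prefix[OF _ ws(2)]) (use L[OF wS] in simp)
    then have "take (length w) (segment x a (a + Suc L)) = w" by (auto simp: prefix_def)
    then have seg: "w = segment x a (a + length w)"
      using L[OF wS] by (simp add: take_segment min_def)
    have "segment x (a + length w) b \<in> initial_segments (concat ` lists S)" for b
    proof (cases "b \<le> a + length w")
      case True
      then show ?thesis using x[of 0] by (simp add: segment_def)
    next
      case False
      have "segment x a b \<in> initial_segments (concat ` lists S)" using a unfolding P_def by blast
      then obtain us where us: "us \<in> lists S" "prefix (segment x a b) (concat us)"
        unfolding initial_segments_def by blast
      have split: "segment x a b = w @ segment x (a + length w) b"
        using segment_append[of a "a + length w" b x] seg False by simp
      have "us \<noteq> []" using us(2) False by (auto dest: prefix_length_le)
      then obtain u us' where u: "us = u # us'" by (cases us) auto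
      have "prefix w (concat us)" using us(2) unfolding split by (meson append_prefixD)
      moreover have "prefix u (concat us)" using u by simp
      ultimately have "w = u" using prefix_free_comparable[OF pf wS] us(1) u by simp
      then have "prefix (segment x (a + length w) b) (concat us')" using us(2) u split by simp
      then show ?thesis using us(1) u unfolding initial_segments_def by auto
    qed
    then have "P (a + length w)" unfolding P_def by blast
    moreover have "length w > 0" using wS ne by auto
    ultimately show ?thesis using seg wS by (metis less_add_same_cancel1)
  qed
  have "\<exists>n. \<forall>i. (P (n i) \<and> (i = 0 \<longrightarrow> n i = 0)) \<and>
      (n i < n (Suc i) \<and> segment x (n i) (n (Suc i)) \<in> S)"
  proof (rule dependent_nat_choice)
    show "\<exists>a. P a \<and> (0 = (0::nat) \<longrightarrow> a = 0)" using x unfolding P_def by blast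
    show "\<exists>b. (P b \<and> (Suc i = 0 \<longrightarrow> b = 0)) \<and> (a < b \<and> segment x a b \<in> S)"
      if "P a \<and> (i = 0 \<longrightarrow> a = 0)" for a i
      using step[of a] that by blast
  qed
  then show ?thesis by (auto simp: strict_mono_Suc_iff)
qed

lemma cuts_unique:
  assumes pf: "prefix_free S"
    and n: "n 0 = 0" "strict_mono n" "\<And>i. segment x (n i) (n (Suc i)) \<in> S"
    and n': "n' 0 = 0" "strict_mono n'" "\<And>i. segment x (n' i) (n' (Suc i)) \<in> S"
  shows "n = (n' :: nat \<Rightarrow> nat)"
proof
  fix i show "n i = n' i"
  proof (induction i)
    case (Suc i)
    have less: "n i < n (Suc i)" "n' i < n' (Suc i)" using n(2) n'(2) by (simp_all add: strict_mono_Suc_iff)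
    let ?b = "max (n (Suc i)) (n' (Suc i))"
    have "prefix (segment x (n i) (n (Suc i))) (segment x (n i) ?b)"
      using less by (metis max.cobounded1 less_imp_le segment_append prefix_def)
    moreover have "prefix (segment x (n i) (n' (Suc i))) (segment x (n i) ?b)"
      using less Suc by (metis max.cobounded2 less_imp_le segment_append prefix_def)
    moreover have "segment x (n i) (n' (Suc i)) \<in> S" using n'(3)[of i] Suc by simp
    ultimately have "segment x (n i) (n (Suc i)) = segment x (n i) (n' (Suc i))"
      using prefix_free_comparable[OF pf n(3)] by blast
    then have "length (segment x (n i) (n (Suc i))) = length (segment x (n i) (n' (Suc i)))" by simp
    then show ?case using less Suc by simp
  qed (simp add: n n')
qed

lemma cut_points:
  assumes "finite (terminal_nodes T)" "prefix_free (terminal_nodes T)" "[] \<notin> terminal_nodes T"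
    and "x \<in> fractal_tree m T"
  shows "cut_points T x 0 = 0" "strict_mono (cut_points T x)"
    and "segment x (cut_points T x i) (cut_points T x (Suc i)) \<in> terminal_nodes T"
proof -
  have "\<exists>!n. n 0 = 0 \<and> strict_mono n \<and> (\<forall>i. segment x (n i) (n (Suc i)) \<in> terminal_nodes T)"
    using cuts_exist[OF assms(1-3), of x] cuts_unique[OF assms(2)] assms(4)
    unfolding fractal_tree_def tree_star_def by (metis (no_types, lifting) mem_Collect_eq)
  from theI'[OF this]
  show "cut_points T x 0 = 0" "strict_mono (cut_points T x)"
    "segment x (cut_points T x i) (cut_points T x (Suc i)) \<in> terminal_nodes T"
    unfolding cut_points_def by blast+
qed

lemma coding_sequence:
  assumes \<tau>: "bij_betw \<tau> {..<k} (terminal_nodes T)"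
    and seg: "segment x (cut_points T x i) (cut_points T x (Suc i)) \<in> terminal_nodes T"
  shows "coding_sequence T k \<tau> x i < k"
    and "\<tau> (coding_sequence T k \<tau> x i) = segment x (cut_points T x i) (cut_points T x (Suc i))"
proof -
  have "\<exists>!j. j < k \<and> segment x (cut_points T x i) (cut_points T x (Suc i)) = \<tau> j"
    using bij_betw_imp_surj_on[OF \<tau>] bij_betw_imp_inj_on[OF \<tau>] seg
    by (auto simp: inj_on_def set_eq_iff image_iff)
  from theI'[OF this]
  show "coding_sequence T k \<tau> x i < k"
    "\<tau> (coding_sequence T k \<tau> x i) = segment x (cut_points T x i) (cut_points T x (Suc i))"
    unfolding coding_sequence_def by simp_all
qed

lemma initial_cut:
  assumes "n 0 = 0" "strict_mono n" "\<And>i. \<tau> (y i) = segment x (n i) (n (Suc i))"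
  shows "initial x (n i) = concat (map \<tau> (initial y i))"
proof (induction i)
  case 0 then show ?case using assms(1) by (simp add: segment_def)
next
  case (Suc i)
  have "initial x (n (Suc i)) = initial x (n i) @ \<tau> (y i)"
    using assms(2,3) by (simp add: segment_append strict_mono_less_eq)
  also have "\<dots> = concat (map \<tau> (initial y i @ [y i]))" using Suc by simp
  also have "initial y i @ [y i] = initial y (Suc i)" by (simp add: segment_def)
  finally show ?case .
qed

section \<open>Encoding and decoding by finite transducers\<close>

text \<open>The state of the encoder holds the last \<open>d\<close> symbols of the concatenation so far, or all of it if it
  is shorter. Withholding them drops exactly \<open>d\<close> symbols wherever the input happens to end, which the
  transducer cannot foresee.\<close>

definition encoder_next :: "(nat \<Rightarrow> nat list) \<Rightarrow> nat \<Rightarrow> nat list \<Rightarrow> nat \<Rightarrow> nat list" where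
  "encoder_next \<tau> d u j = drop (length (u @ \<tau> j) - d) (u @ \<tau> j)"

definition encoder_out :: "(nat \<Rightarrow> nat list) \<Rightarrow> nat \<Rightarrow> nat list \<Rightarrow> nat \<Rightarrow> nat list" where
  "encoder_out \<tau> d u j = take (length (u @ \<tau> j) - d) (u @ \<tau> j)"

lemma transducer_encoder:
  assumes "\<And>j. j < k \<Longrightarrow> \<tau> j \<in> words m"
  shows "transducer k m (encoder_next \<tau> d) (encoder_out \<tau> d) [] {u \<in> words m. length u \<le> d}"
proof -
  have "{u \<in> words m. length u \<le> d} = {u. set u \<subseteq> {..<m} \<and> length u \<le> d}"
    by (auto simp: words_def)
  then have "finite {u \<in> words m. length u \<le> d}"
    using finite_lists_length_le[of "{..<m}" d] by simp
  moreover have "encoder_next \<tau> d u j \<in> {u \<in> words m. length u \<le> d} \<and> encoder_out \<tau> d u j \<in> words m"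
    if "u \<in> words m" "j < k" for u j
  proof -
    have "u @ \<tau> j \<in> words m" using that assms[of j] by (simp add: words_def)
    then have "drop l (u @ \<tau> j) \<in> words m" "take l (u @ \<tau> j) \<in> words m" for l
      unfolding words_def by (meson in_lists_conv_set in_set_dropD in_set_takeD)+
    then show ?thesis by (simp add: encoder_next_def encoder_out_def del: length_append take_append drop_append)
  qed
  ultimately show ?thesis by (simp add: transducer_def words_def)
qed

lemma transduce_encoder:
  assumes "length u \<le> d"
  shows "transduce (encoder_next \<tau> d) (encoder_out \<tau> d) u ys =
    take (length (u @ concat (map \<tau> ys)) - d) (u @ concat (map \<tau> ys))"
  using assms
proof (induction ys arbitrary: u)
  case (Cons j ys)
  define v where "v = u @ \<tau> j"
  define e where "e = length v - d"
  have "length (encoder_next \<tau> d u j) \<le> d" by (simp add: encoder_next_def)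
  note IH = Cons.IH[OF this]
  have next_out: "encoder_next \<tau> d u j = drop e v" "encoder_out \<tau> d u j = take e v"
    by (simp_all only: encoder_next_def encoder_out_def v_def e_def)
  define W where "W = concat (map \<tau> ys)"
  have "take (length (v @ W) - d) (v @ W) = take e v @ take (length (drop e v @ W) - d) (drop e v @ W)"
  proof -
    have "v @ W = take e v @ (drop e v @ W)" by simp
    then have "take (length (v @ W) - d) (v @ W) = take (length (v @ W) - d) (take e v @ (drop e v @ W))"
      by presburger
    moreover have "length (take e v) = e" "e \<le> length (v @ W) - d"
        "length (v @ W) - d - e = length (drop e v @ W) - d"
      by (auto simp: e_def)
    ultimately show ?thesis by (simp only: take_append) simp
  qed
  then show ?case using IH by (simp add: next_out W_def v_def)
qed simp

text \<open>The state of the decoder is the part of the current node that has been read. It is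
  reset to \<open>[]\<close> at the end of a node, and also when the input leaves the tree: the set of states has
  to be finite whatever the machine writes.\<close>

definition decoder_next :: "nat list set \<Rightarrow> nat list \<Rightarrow> nat \<Rightarrow> nat list" where
  "decoder_next T u c = (if u @ [c] \<in> T - terminal_nodes T then u @ [c] else [])"

definition decoder_out :: "nat list set \<Rightarrow> nat \<Rightarrow> (nat \<Rightarrow> nat list) \<Rightarrow> nat list \<Rightarrow> nat \<Rightarrow> nat list" where
  "decoder_out T k \<tau> u c =
     (if u @ [c] \<in> terminal_nodes T then [the_inv_into {..<k} \<tau> (u @ [c])] else [])"

lemma transducer_decoder:
  assumes "finite T" and \<tau>: "bij_betw \<tau> {..<k} (terminal_nodes T)"
  shows "transducer m k (decoder_next T) (decoder_out T k \<tau>) [] (insert [] T)"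
proof -
  have "the_inv_into {..<k} \<tau> v < k" if "v \<in> terminal_nodes T" for v
    using bij_betwE[OF bij_betw_the_inv_into[OF \<tau>]] that by auto
  then show ?thesis
    using assms(1) by (auto simp: transducer_def decoder_next_def decoder_out_def words_def)
qed

lemma decoder_inside_node:
  assumes closed: "\<And>u v. v \<in> T \<Longrightarrow> prefix u v \<Longrightarrow> u \<in> T"
    and v: "v \<in> terminal_nodes T" and u: "strict_prefix u v"
  shows "foldl (decoder_next T) [] u = u \<and> transduce (decoder_next T) (decoder_out T k \<tau>) [] u = []"
  using u
proof (induction u rule: rev_induct)
  case (snoc c u)
  have "strict_prefix u v" using snoc.prems
    by (meson append_prefixD prefix_order.less_le_trans prefix_order.less_imp_le prefix_snocD)
  note IH = snoc.IH[OF this]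
  have "u @ [c] \<in> T"
    using closed v snoc.prems by (auto simp: terminal_nodes_def strict_prefix_def)
  moreover have "u @ [c] \<notin> terminal_nodes T"
    using v snoc.prems by (auto simp: terminal_nodes_def)
  ultimately show ?case
    using IH by (simp add: transduce_append decoder_next_def decoder_out_def)
qed simp

lemma decoder_node:
  assumes closed: "\<And>u v. v \<in> T \<Longrightarrow> prefix u v \<Longrightarrow> u \<in> T"
    and \<tau>: "bij_betw \<tau> {..<k} (terminal_nodes T)" and ne: "[] \<notin> terminal_nodes T" and j: "j < k"
  shows "foldl (decoder_next T) [] (\<tau> j) = [] \<and>
         transduce (decoder_next T) (decoder_out T k \<tau>) [] (\<tau> j) = [j]"
proof -
  have \<tau>j: "\<tau> j \<in> terminal_nodes T" using \<tau> j by (auto dest: bij_betwE)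
  then have "\<tau> j \<noteq> []" using ne by metis
  then obtain u c where u: "\<tau> j = u @ [c]" by (metis rev_exhaust)
  have "strict_prefix u (\<tau> j)" using u by (simp add: strict_prefix_def)
  note inside = decoder_inside_node[where k = k and \<tau> = \<tau>, OF closed \<tau>j this]
  have "the_inv_into {..<k} \<tau> (u @ [c]) = j"
    using the_inv_into_f_f[OF bij_betw_imp_inj_on[OF \<tau>], of j] j u by simp
  then show ?thesis
    using inside \<tau>j u by (simp add: transduce_append decoder_next_def decoder_out_def)
qed

text \<open>An unfinished node at the end of the input produces no output, so it does no harm that the input
  stops between two cut points.\<close>

lemma transduce_decoder:
  assumes closed: "\<And>u v. v \<in> T \<Longrightarrow> prefix u v \<Longrightarrow> u \<in> T"
    and \<tau>: "bij_betw \<tau> {..<k} (terminal_nodes T)" and ne: "[] \<notin> terminal_nodes T"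
    and ys: "set ys \<subseteq> {..<k}" and v: "v \<in> terminal_nodes T" "strict_prefix u v"
  shows "transduce (decoder_next T) (decoder_out T k \<tau>) [] (concat (map \<tau> ys) @ u) = ys"
  using ys
proof (induction ys)
  case Nil
  show ?case using decoder_inside_node[OF closed v] by simp
next
  case (Cons j ys)
  then show ?case using decoder_node[where j = j, OF closed \<tau> ne] by (simp add: transduce_append)
qed

section \<open>Channel capacity, similarity dimension and cylinder measures\<close>

text \<open>The sum is strictly decreasing in \<open>\<alpha>\<close>. It is \<open>k\<close> at \<open>0\<close> and at most \<open>1\<close> at \<open>log 2 k\<close>, where each
  summand is at most \<open>1 / k\<close>. Uniqueness is among all reals, as the definition of the similarity
  dimension requires.\<close>

lemma capacity_ex1:
  fixes len :: "nat \<Rightarrow> nat"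
  assumes k: "k \<ge> 2" and len: "\<forall>i<k. len i > 0"
  shows "\<exists>\<alpha>>0. (\<Sum>i<k. 2 powr (- \<alpha> * real (len i))) = 1 \<and>
           (\<forall>\<alpha>'. (\<Sum>i<k. 2 powr (- \<alpha>' * real (len i))) = 1 \<longrightarrow> \<alpha>' = \<alpha>)"
proof -
  define g where "g \<alpha> = (\<Sum>i<k. 2 powr (- \<alpha> * real (len i)))" for \<alpha> :: real
  have anti: "g b < g a" if "a < b" for a b
    unfolding g_def using k len that by (intro sum_strict_mono) (auto simp: lessThan_empty_iff)
  have "\<exists>\<alpha>. 0 \<le> \<alpha> \<and> \<alpha> \<le> log 2 (real k) \<and> g \<alpha> = 1"
  proof (rule IVT2)
    have "g (log 2 (real k)) \<le> (\<Sum>i<k. 2 powr (- log 2 (real k)))"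
      unfolding g_def
    proof (rule sum_mono)
      fix i assume "i \<in> {..<k}"
      then have "1 \<le> real (len i)" using len by (simp add: Suc_le_eq)
      moreover have "0 \<le> log 2 (real k)" using k by simp
      ultimately have "log 2 (real k) * 1 \<le> log 2 (real k) * real (len i)" by (intro mult_left_mono) auto
      then show "2 powr (- log 2 (real k) * real (len i)) \<le> 2 powr (- log 2 (real k))" by simp
    qed
    also have "\<dots> = 1" using k by (simp add: powr_minus)
    finally show "g (log 2 (real k)) \<le> 1" .
    show "1 \<le> g 0" using k by (simp add: g_def)
    show "0 \<le> log 2 (real k)" using k by simp
    show "\<forall>\<alpha>. 0 \<le> \<alpha> \<and> \<alpha> \<le> log 2 (real k) \<longrightarrow> isCont g \<alpha>"
      unfolding g_def by (intro allI impI continuous_intros) auto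
  qed
  then obtain \<alpha> where \<alpha>: "0 \<le> \<alpha>" "g \<alpha> = 1" by blast
  have "g 0 \<noteq> 1" using k by (simp add: g_def)
  then have "\<alpha> \<noteq> 0" using \<alpha> by metis
  moreover have "\<alpha>' = \<alpha>" if "g \<alpha>' = 1" for \<alpha>'
    using anti[of \<alpha> \<alpha>'] anti[of \<alpha>' \<alpha>] \<alpha> that by (cases \<alpha> \<alpha>' rule: linorder_cases) auto
  ultimately show ?thesis using \<alpha> unfolding g_def by (metis less_eq_real_def)
qed

lemma channel_capacity:
  assumes "k \<ge> 2" and "\<forall>i<k. len i > 0"
  shows "channel_capacity k len > 0"
    and "(\<Sum>i<k. 2 powr (- channel_capacity k len * real (len i))) = 1"
    and "(\<Sum>i<k. 2 powr (- \<alpha> * real (len i))) = 1 \<Longrightarrow> \<alpha> = channel_capacity k len"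
proof -
  obtain \<gamma> where \<gamma>: "\<gamma> > 0" "(\<Sum>i<k. 2 powr (- \<gamma> * real (len i))) = 1"
      "\<And>\<alpha>. (\<Sum>i<k. 2 powr (- \<alpha> * real (len i))) = 1 \<Longrightarrow> \<alpha> = \<gamma>"
    using capacity_ex1[of k len, OF assms] by blast
  have "channel_capacity k len = \<gamma>"
    unfolding channel_capacity_def
  proof (rule the_equality)
    show "\<gamma> \<ge> 0 \<and> (\<Sum>i<k. 2 powr (- \<gamma> * real (len i))) = 1"
      using \<gamma>(1,2) by simp
  qed (use \<gamma>(3) in blast)
  with \<gamma> show "channel_capacity k len > 0"
    and "(\<Sum>i<k. 2 powr (- channel_capacity k len * real (len i))) = 1"
    and "(\<Sum>i<k. 2 powr (- \<alpha> * real (len i))) = 1 \<Longrightarrow> \<alpha> = channel_capacity k len"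
    by blast+
qed

lemma sdim_eq_capacity:
  assumes m: "m \<ge> 2" and k: "k \<ge> 2" and \<tau>: "bij_betw \<tau> {..<k} (terminal_nodes T)"
    and ne: "[] \<notin> terminal_nodes T"
  shows "sdim m T = channel_capacity k (\<lambda>i. length (\<tau> i)) / log 2 (real m)"
proof -
  define \<alpha> where "\<alpha> = channel_capacity k (\<lambda>i. length (\<tau> i))"
  have "\<forall>i<k. length (\<tau> i) > 0"
    using bij_betwE[OF \<tau>] ne by (metis length_greater_0_conv lessThan_iff)
  note cap = channel_capacity[where len = "\<lambda>i. length (\<tau> i)", OF k this, folded \<alpha>_def]
  have log: "log 2 (real m) > 0" using m by simp
  have "real m powr z = 2 powr (log 2 (real m) * z)" for z
    using m by (simp add: powr_def log_def)
  then have sum: "(\<Sum>\<sigma>\<in>terminal_nodes T. real m powr (- \<beta> * real (length \<sigma>))) =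
      (\<Sum>i<k. 2 powr (- (\<beta> * log 2 (real m)) * real (length (\<tau> i))))" for \<beta>
    by (subst sum.reindex_bij_betw[OF \<tau>, symmetric]) (simp add: mult_ac)
  show ?thesis
    unfolding sdim_def sum \<alpha>_def[symmetric]
  proof (rule the_equality)
    show "(\<Sum>i<k. 2 powr (- (\<alpha> / log 2 (real m) * log 2 (real m)) * real (length (\<tau> i)))) = 1"
      using cap(2) log by simp
    show "\<beta> = \<alpha> / log 2 (real m)"
      if "(\<Sum>i<k. 2 powr (- (\<beta> * log 2 (real m)) * real (length (\<tau> i)))) = 1" for \<beta>
      using cap(3)[OF that] log by (simp add: field_simps)
  qed
qed

lemma cylinder_measure_length_measure:
  assumes k: "k \<ge> 2" and len: "\<forall>i<k. len i > 0" and y: "\<And>i. y i < k"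
  shows "cylinder_measure (length_measure k len) (initial y n) =
     2 powr (- channel_capacity k len * real (\<Sum>i<n. len (y i)))"
proof -
  define \<alpha> where "\<alpha> = channel_capacity k len"
  define r where "r = 2 powr (- \<alpha>)"
  define N where "N = point_measure {..<k} (\<lambda>i. ennreal (r ^ len i))"
  have r: "r ^ l = 2 powr (- \<alpha> * real l)" for l
    by (simp add: r_def powr_powr flip: powr_realpow)
  have r0: "r > 0" by (simp add: r_def)
  have "emeasure N (space N) = ennreal (\<Sum>i<k. r ^ len i)"
    using r0 by (simp add: N_def space_point_measure emeasure_point_measure_finite sum_ennreal)
  also have "(\<Sum>i<k. r ^ len i) = 1"
    using channel_capacity(2)[of k len, OF k len] by (simp add: r \<alpha>_def)
  finally interpret N: prob_space N by (intro prob_spaceI) simp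
  interpret P: product_prob_space "\<lambda>_. N" "UNIV :: nat set" by unfold_locales
  have \<mu>: "length_measure k len = Pi\<^sub>M UNIV (\<lambda>_. N)"
    by (simp add: length_measure_def N_def r_def \<alpha>_def Let_def)
  have single: "measure N {y i} = r ^ len (y i)" for i
    using y[of i] r0 by (simp add: N_def measure_def emeasure_point_measure_finite)
  have "{z \<in> space (Pi\<^sub>M UNIV (\<lambda>_. N)). initial z (length (initial y n)) = initial y n} =
      prod_emb UNIV (\<lambda>_. N) {..<n} (Pi\<^sub>E {..<n} (\<lambda>i. {y i}))"
    by (auto simp: prod_emb_def space_PiM segment_def PiE_iff extensional_def)
  then have "cylinder_measure (length_measure k len) (initial y n) = (\<Prod>i<n. measure N {y i})"
    unfolding cylinder_measure_def \<mu>
    using y by (simp only:) (subst P.measure_PiM_emb; auto simp: N_def sets_point_measure)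
  also have "\<dots> = r ^ (\<Sum>i<n. len (y i))" by (simp add: single power_sum)
  finally show ?thesis by (simp only: r \<alpha>_def)
qed

section \<open>Limits inferior and superior of perturbed sequences\<close>

text \<open>Along \<open>s\<close> the sequence can only lose values that occur infinitely often: a property that holds
  eventually still holds eventually after composition with \<open>s\<close>.\<close>

lemma limsup_compose_le:
  fixes f :: "nat \<Rightarrow> ereal"
  assumes "filterlim s at_top sequentially"
  shows "limsup (\<lambda>n. f (s n)) \<le> limsup f"
proof -
  have "limsup (\<lambda>n. f (s n)) \<le> Sup (f ` Collect P)" if "eventually P sequentially" for P
  proof (rule Limsup_bounded)
    show "\<forall>\<^sub>F n in sequentially. f (s n) \<le> Sup (f ` Collect P)"
      using eventually_compose_filterlim[OF that assms]
      by (auto elim!: eventually_mono intro: SUP_upper)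
  qed
  then show ?thesis unfolding Limsup_def[of _ f] by (auto intro: INF_greatest)
qed

lemma liminf_compose_ge:
  fixes f :: "nat \<Rightarrow> ereal"
  assumes "filterlim s at_top sequentially"
  shows "liminf f \<le> liminf (\<lambda>n. f (s n))"
  using limsup_compose_le[OF assms, of "\<lambda>n. - f n"] by (simp add: ereal_Limsup_uminus)

text \<open>The factor \<open>\<rho>\<close> stands for a quotient of denominators. Replacing it by a summand would only be
  legitimate for bounded \<open>q\<close>.\<close>

lemma limsup_le_perturbed:
  fixes p q \<rho> \<epsilon> :: "nat \<Rightarrow> real"
  assumes le: "\<forall>\<^sub>F n in sequentially. p n \<le> \<rho> n * q (s n) + \<epsilon> n"
    and s: "filterlim s at_top sequentially" and \<rho>: "\<rho> \<longlonglongrightarrow> 1" and \<epsilon>: "\<epsilon> \<longlonglongrightarrow> 0"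
  shows "limsup (\<lambda>n. ereal (p n)) \<le> limsup (\<lambda>n. ereal (q n))"
proof -
  have "limsup (\<lambda>n. ereal (p n)) \<le> limsup (\<lambda>n. ereal (\<epsilon> n) + ereal (\<rho> n) * ereal (q (s n)))"
    using le by (intro Limsup_mono) (auto elim!: eventually_mono simp: add.commute)
  also have "\<dots> = 0 + limsup (\<lambda>n. ereal (\<rho> n) * ereal (q (s n)))"
    using \<epsilon> by (intro ereal_limsup_lim_add) (auto simp: zero_ereal_def)
  also have "limsup (\<lambda>n. ereal (\<rho> n) * ereal (q (s n))) = 1 * limsup (\<lambda>n. ereal (q (s n)))"
    using \<rho> by (intro ereal_limsup_lim_mult) (auto simp: one_ereal_def)
  also have "0 + 1 * limsup (\<lambda>n. ereal (q (s n))) \<le> limsup (\<lambda>n. ereal (q n))"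
    using limsup_compose_le[OF s, of "\<lambda>n. ereal (q n)"] by simp
  finally show ?thesis .
qed

lemma liminf_le_perturbed:
  fixes p q \<rho> \<epsilon> :: "nat \<Rightarrow> real"
  assumes le: "\<forall>\<^sub>F n in sequentially. p (s n) \<le> \<rho> n * q n + \<epsilon> n"
    and s: "filterlim s at_top sequentially" and \<rho>: "\<rho> \<longlonglongrightarrow> 1" and \<epsilon>: "\<epsilon> \<longlonglongrightarrow> 0"
  shows "liminf (\<lambda>n. ereal (p n)) \<le> liminf (\<lambda>n. ereal (q n))"
proof -
  have "liminf (\<lambda>n. ereal (p n)) \<le> liminf (\<lambda>n. ereal (p (s n)))"
    using liminf_compose_ge[OF s, of "\<lambda>n. ereal (p n)"] .
  also have "\<dots> \<le> liminf (\<lambda>n. ereal (\<epsilon> n) + ereal (\<rho> n) * ereal (q n))"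
    using le by (intro Liminf_mono) (auto elim!: eventually_mono simp: add.commute)
  also have "\<dots> = 0 + liminf (\<lambda>n. ereal (\<rho> n) * ereal (q n))"
    using \<epsilon> by (intro ereal_liminf_lim_add) (auto simp: zero_ereal_def)
  also have "liminf (\<lambda>n. ereal (\<rho> n) * ereal (q n)) = 1 * liminf (\<lambda>n. ereal (q n))"
    using \<rho> by (intro ereal_liminf_lim_mult) (auto simp: one_ereal_def)
  finally show ?thesis by simp
qed

text \<open>Each of the four inequalities bounds one quotient by the other along a suitable change of index. At
  the cuts themselves the denominators coincide. For general \<open>r\<close>, the lower limit uses the last cut at
  or before \<open>r\<close>, and the upper limit uses the next one, since a quotient at \<open>r\<close> is bounded above by
  encoding from a position beyond \<open>r\<close>.\<close>

lemma ratio_limits_along_cuts: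
  fixes a b n :: "nat \<Rightarrow> nat" and c :: real
  assumes n0: "n 0 = 0" and mono: "strict_mono n" and gap: "\<And>i. n (Suc i) \<le> n i + L" and c: "c > 0"
    and a_le: "\<And>i r. n i \<le> r \<Longrightarrow> r < n (Suc i) \<Longrightarrow> a i \<le> b r + C"
    and b_le: "\<And>i r. r \<le> n i \<Longrightarrow> n i \<le> r + L \<Longrightarrow> b r \<le> a i + C"
  shows "liminf (\<lambda>r. ereal (real (b r) / (real r * c))) = liminf (\<lambda>i. ereal (real (a i) / (real (n i) * c)))"
    and "limsup (\<lambda>r. ereal (real (b r) / (real r * c))) = limsup (\<lambda>i. ereal (real (a i) / (real (n i) * c)))"
proof -
  have less: "n i < n (Suc i)" for i using mono by (simp add: strict_mono_Suc_iff)
  have "\<exists>i. n i \<le> r \<and> r < n (Suc i)" for r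
  proof (induction r)
    case 0
    then show ?case using n0 less[of 0] by auto
  next
    case (Suc r)
    then obtain i where i: "n i \<le> r" "r < n (Suc i)" by blast
    show ?case
    proof (cases "Suc r < n (Suc i)")
      case True
      then show ?thesis using i(1) le_SucI by blast
    next
      case False
      then have "Suc r = n (Suc i)" using i(2) by simp
      then show ?thesis using less[of "Suc i"] by auto
    qed
  qed
  then have "\<exists>s. \<forall>r. n (s r) \<le> r \<and> r < n (Suc (s r))" by (rule choice[OF allI])
  then obtain s where s: "\<And>r. n (s r) \<le> r" "\<And>r. r < n (Suc (s r))" by blast
  have n_top: "filterlim n at_top sequentially" by (rule filterlim_subseq[OF mono])
  have s_top: "filterlim s at_top sequentially"
    unfolding filterlim_at_top
  proof
    fix Z
    have "Z \<le> s r" if "n Z \<le> r" for r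
    proof -
      have "n Z < n (Suc (s r))" using s(2)[of r] that by linarith
      then have "Z < Suc (s r)" using strict_mono_less[OF mono] by blast
      then show ?thesis by simp
    qed
    then show "\<forall>\<^sub>F r in sequentially. Z \<le> s r"
      unfolding eventually_sequentially by blast
  qed
  have Suc_s_top: "filterlim (\<lambda>r. Suc (s r)) at_top sequentially"
    by (rule filterlim_compose[OF filterlim_Suc s_top])
  have ns_top: "filterlim (\<lambda>r. n (s r)) at_top sequentially"
    by (rule filterlim_compose[OF n_top s_top])
  have inv: "(\<lambda>r. K / real (f r)) \<longlonglongrightarrow> 0" if "filterlim f at_top sequentially" for K :: real and f :: "nat \<Rightarrow> nat"
    by (rule real_tendsto_divide_at_top[OF tendsto_const
          filterlim_compose[OF filterlim_real_sequentially that]])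
  have inv_c: "(\<lambda>r. real C / (real (f r) * c)) \<longlonglongrightarrow> 0" if "filterlim f at_top sequentially" for f :: "nat \<Rightarrow> nat"
    using inv[OF that, of "real C / c"] by (simp add: mult.commute)
  have pos: "\<forall>\<^sub>F r in sequentially. 0 < f r" if "filterlim f at_top sequentially" for f :: "nat \<Rightarrow> nat"
    using that unfolding filterlim_at_top by (auto elim!: allE[of _ 1] eventually_mono)
  have id_top: "filterlim (\<lambda>r::nat. r) at_top sequentially" by (rule filterlim_ident)
  have ratio: "(\<lambda>r. real (g r) / real (f r)) \<longlonglongrightarrow> 1"
    if f: "filterlim f at_top sequentially" and g: "\<And>r. f r \<le> g r" "\<And>r. g r \<le> f r + L" for f g :: "nat \<Rightarrow> nat"
  proof (rule tendsto_sandwich)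
    show "\<forall>\<^sub>F r in sequentially. 1 \<le> real (g r) / real (f r)"
      using pos[OF f] by eventually_elim (use g in simp)
    show "\<forall>\<^sub>F r in sequentially. real (g r) / real (f r) \<le> 1 + real L / real (f r)"
      using pos[OF f]
    proof eventually_elim
      case (elim r)
      have "real (g r) \<le> real (f r) + real L" using g(2)[of r] by linarith
      then show ?case using elim by (simp add: field_simps)
    qed
    show "(\<lambda>r. 1 + real L / real (f r)) \<longlonglongrightarrow> 1"
      using tendsto_add[OF tendsto_const inv[OF f, of "real L"], of 1] by simp
  qed simp
  have at_cuts: "b (n i) \<le> a i + C" "a i \<le> b (n i) + C" for i
    using b_le[of "n i" i] a_le[of i "n i"] strict_monoD[OF mono, of i "Suc i"] by auto
  show "liminf (\<lambda>r. ereal (real (b r) / (real r * c))) = liminf (\<lambda>i. ereal (real (a i) / (real (n i) * c)))"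
  proof (rule antisym)
    show "liminf (\<lambda>r. ereal (real (b r) / (real r * c))) \<le> liminf (\<lambda>i. ereal (real (a i) / (real (n i) * c)))"
    proof (rule liminf_le_perturbed[OF _ n_top tendsto_const inv_c[OF n_top]], rule always_eventually, rule allI)
      fix i
      have "real (b (n i)) \<le> real (a i) + real C" using at_cuts(1)[of i] by linarith
      then have "real (b (n i)) / (real (n i) * c) \<le> (real (a i) + real C) / (real (n i) * c)"
        using c by (intro divide_right_mono) auto
      then show "real (b (n i)) / (real (n i) * c) \<le> 1 * (real (a i) / (real (n i) * c)) + real C / (real (n i) * c)"
        by (simp add: add_divide_distrib)
    qed
    show "liminf (\<lambda>i. ereal (real (a i) / (real (n i) * c))) \<le> liminf (\<lambda>r. ereal (real (b r) / (real r * c)))"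
    proof (rule liminf_le_perturbed[OF _ s_top ratio[OF ns_top] inv_c[OF ns_top]])
      show "n (s r) \<le> r" "r \<le> n (s r) + L" for r
        using s[of r] gap[of "s r"] by auto
      show "\<forall>\<^sub>F r in sequentially. real (a (s r)) / (real (n (s r)) * c) \<le>
          real r / real (n (s r)) * (real (b r) / (real r * c)) + real C / (real (n (s r)) * c)"
        using pos[OF ns_top]
      proof eventually_elim
        case (elim r)
        have "real (a (s r)) \<le> real (b r) + real C"
          using a_le[OF s(1)[of r] s(2)[of r]] by linarith
        then have "real (a (s r)) / (real (n (s r)) * c) \<le> (real (b r) + real C) / (real (n (s r)) * c)"
          using c by (intro divide_right_mono) auto
        moreover have "r > 0" using elim s(1)[of r] by simp
        ultimately show ?case by (simp add: add_divide_distrib)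
      qed
    qed
  qed
  show "limsup (\<lambda>r. ereal (real (b r) / (real r * c))) = limsup (\<lambda>i. ereal (real (a i) / (real (n i) * c)))"
  proof (rule antisym)
    show "limsup (\<lambda>i. ereal (real (a i) / (real (n i) * c))) \<le> limsup (\<lambda>r. ereal (real (b r) / (real r * c)))"
    proof (rule limsup_le_perturbed[OF _ n_top tendsto_const inv_c[OF n_top]], rule always_eventually, rule allI)
      fix i
      have "real (a i) \<le> real (b (n i)) + real C" using at_cuts(2)[of i] by linarith
      then have "real (a i) / (real (n i) * c) \<le> (real (b (n i)) + real C) / (real (n i) * c)"
        using c by (intro divide_right_mono) auto
      then show "real (a i) / (real (n i) * c) \<le> 1 * (real (b (n i)) / (real (n i) * c)) + real C / (real (n i) * c)"
        by (simp add: add_divide_distrib)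
    qed
    show "limsup (\<lambda>r. ereal (real (b r) / (real r * c))) \<le> limsup (\<lambda>i. ereal (real (a i) / (real (n i) * c)))"
    proof (rule limsup_le_perturbed[OF _ Suc_s_top ratio[OF id_top] inv_c[OF id_top]])
      show "r \<le> n (Suc (s r))" "n (Suc (s r)) \<le> r + L" for r
        using s[of r] gap[of "s r"] by auto
      show "\<forall>\<^sub>F r in sequentially. real (b r) / (real r * c) \<le>
          real (n (Suc (s r))) / real r * (real (a (Suc (s r))) / (real (n (Suc (s r))) * c)) + real C / (real r * c)"
        using pos[OF id_top]
      proof eventually_elim
        case (elim r)
        have "real (b r) \<le> real (a (Suc (s r))) + real C"
          using b_le[of r "Suc (s r)"] s[of r] gap[of "s r"] by linarith
        then have "real (b r) / (real r * c) \<le> (real (a (Suc (s r))) + real C) / (real r * c)"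
          using c by (intro divide_right_mono) auto
        moreover have "n (Suc (s r)) > 0" using elim s(2)[of r] by simp
        ultimately show ?case by (simp add: add_divide_distrib)
      qed
    qed
  qed
qed

section \<open>The dimension formula\<close>

lemma prefix_unary:
  assumes "u \<in> words m" "v \<in> words m" "m \<le> 1" "length u \<le> length v"
  shows "prefix u v"
proof -
  have rep: "w = replicate (length w) 0" if "w \<in> words m" for w
    using that assms(3) by (intro replicate_eqI) (auto simp: words_def)
  have "replicate (length v) (0::nat) = replicate (length u) 0 @ replicate (length v - length u) 0"
    using assms(4) by (simp flip: replicate_add)
  then have "prefix (replicate (length u) (0::nat)) (replicate (length v) 0)"
    by (simp add: prefix_def)
  then show ?thesis using rep[OF assms(1)] rep[OF assms(2)] by metis
qed

lemma finite_tree_properties: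
  assumes "finite_tree m T"
  shows "finite T" and "finite (terminal_nodes T)" and "terminal_nodes T \<subseteq> words m"
    and "prefix_free (terminal_nodes T)" and "\<And>u v. v \<in> T \<Longrightarrow> prefix u v \<Longrightarrow> u \<in> T"
proof -
  obtain S where S: "finite S" "S \<subseteq> words m" "prefix_free S" "T = initial_segments S"
    using assms unfolding finite_tree_def by blast
  have "T = (\<Union>\<sigma>\<in>S. set (prefixes \<sigma>))" using S(4) by (auto simp: initial_segments_def)
  with S(1) show "finite T" by simp
  show "finite (terminal_nodes T)" "terminal_nodes T \<subseteq> words m" "prefix_free (terminal_nodes T)"
    using S terminal_nodes_initial_segments[OF S(3)] by simp_all
  show "\<And>u v. v \<in> T \<Longrightarrow> prefix u v \<Longrightarrow> u \<in> T"
    unfolding S(4) initial_segments_def by (blast intro: prefix_order.trans)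
qed

text \<open>If the empty string were a terminal node, it would be the only one; and over fewer than two symbols
  any two strings are comparable.\<close>

lemma branching_tree:
  fixes k :: nat
  assumes T: "finite_tree m T" and k: "k \<ge> 2" and \<tau>: "bij_betw \<tau> {..<k} (terminal_nodes T)"
  shows "[] \<notin> terminal_nodes T" and "m \<ge> 2"
proof -
  note T = finite_tree_properties[OF T]
  have \<tau>01: "\<tau> 0 \<in> terminal_nodes T" "\<tau> 1 \<in> terminal_nodes T" "\<tau> 0 \<noteq> \<tau> 1"
    using k bij_betwE[OF \<tau>] inj_onD[OF bij_betw_imp_inj_on[OF \<tau>], of 0 1] by auto
  have incomparable: "u = v" if "u \<in> terminal_nodes T" "v \<in> terminal_nodes T" "prefix u v" for u v
    using prefix_free_comparable[OF T(4) that(1,2) that(3)] by simp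
  show "[] \<notin> terminal_nodes T"
    using incomparable[of "[]" "\<tau> 0"] incomparable[of "[]" "\<tau> 1"] \<tau>01 by auto
  show "m \<ge> 2"
  proof (rule ccontr)
    assume "\<not> m \<ge> 2"
    then have "prefix (\<tau> 0) (\<tau> 1) \<or> prefix (\<tau> 1) (\<tau> 0)"
      using \<tau>01 T(3) by (cases "length (\<tau> 0) \<le> length (\<tau> 1)") (auto intro: prefix_unary)
    then show False using incomparable \<tau>01 by metis
  qed
qed

lemma initial_in_words: "(\<And>i. y i < p) \<Longrightarrow> initial y i \<in> words p"
  by (auto simp: words_def segment_def)

text \<open>Since \<open>d\<close> is bounded, finitely many encoders suffice, and one constant serves them all.\<close>

lemma complexity_le_complexity_code:
  assumes M: "effective_enumeration k M" and N: "effective_enumeration m N"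
    and \<tau>: "\<And>j. j < k \<Longrightarrow> \<tau> j \<in> words m"
  shows "\<exists>C. \<forall>ys\<in>words k. \<forall>d\<le>L.
    complexity N (take (length (concat (map \<tau> ys)) - d) (concat (map \<tau> ys))) \<le> complexity M ys + C"
proof -
  have "\<exists>C. \<forall>ys\<in>words k.
    complexity N (take (length (concat (map \<tau> ys)) - d) (concat (map \<tau> ys))) \<le> complexity M ys + C" for d
    using complexity_transduce_le[OF M N transducer_encoder[of k \<tau> m d, OF \<tau>]]
      describable[OF M] transduce_encoder[of "[]" d \<tau>] by simp blast
  then obtain C where C: "\<And>d ys. ys \<in> words k \<Longrightarrow>
    complexity N (take (length (concat (map \<tau> ys)) - d) (concat (map \<tau> ys))) \<le> complexity M ys + C d"
    by metis
  have "C d \<le> (\<Sum>d\<le>L. C d)" if "d \<le> L" for d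
    using that by (intro member_le_sum) auto
  then show ?thesis using C by (meson add_left_mono le_trans)
qed

theorem theorem4p2:
  fixes M :: "nat \<Rightarrow> nat \<Rightarrow> nat list \<rightharpoonup> nat list"
    and m k :: nat
    and T :: "nat list set"
    and \<tau> :: "nat \<Rightarrow> nat list"
    and len :: "nat \<Rightarrow> nat"
    and \<mu> :: "(nat \<Rightarrow> nat) measure"
    and x y :: "nat \<Rightarrow> nat"
  assumes "\<And>p. effective_enumeration p (M p)"
    and "k \<ge> 2"
    and "finite_tree m T"
    and "bij_betw \<tau> {..<k} (terminal_nodes T)"
    and "len = (\<lambda>i. length (\<tau> i))"
    and "\<mu> = length_measure k len"
    and "x \<in> fractal_tree m T"
    and "y = coding_sequence T k \<tau> x"
  shows "eff_dim (M m) m x = ereal (sdim m T) * eff_dim_measure (M k) \<mu> y \<and>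
         eff_Dim (M m) m x = ereal (sdim m T) * eff_Dim_measure (M k) \<mu> y"
proof -
  note M = assms(1) and k = assms(2) and \<tau> = assms(4)
  note T = finite_tree_properties[OF assms(3)]
  note branching = branching_tree[OF assms(3) k \<tau>]
  have \<tau>_mem: "\<tau> j \<in> terminal_nodes T" if "j < k" for j using bij_betwE[OF \<tau>] that by auto
  define n where "n = cut_points T x"
  note cuts = cut_points[OF T(2,4) branching(1) assms(7), folded n_def]
  have y: "y i < k" and \<tau>y: "\<tau> (y i) = segment x (n i) (n (Suc i))" for i
    using coding_sequence[OF \<tau>, of x i] cuts(3)[of i] unfolding assms(8) n_def by auto
  have code: "initial x (n i) = concat (map \<tau> (initial y i))" for i
    by (rule initial_cut[of n \<tau> y x, OF cuts(1,2) \<tau>y])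
  have len_y: "n (Suc i) = n i + len (y i)" for i
    using arg_cong[OF \<tau>y[of i], of length] strict_monoD[OF cuts(2), of i "Suc i"]
    by (simp add: assms(5))
  then have n_sum: "n i = (\<Sum>j<i. len (y j))" for i
    by (induction i) (simp_all add: cuts(1))
  \<comment> \<open>A crude bound for the length of a node.\<close>
  define L where "L = (\<Sum>j<k. len j)"
  have gap: "n (Suc i) \<le> n i + L" for i
    using member_le_sum[of "y i" "{..<k}" len] y[of i] by (simp add: len_y L_def)
  have x_words: "initial x r \<in> words m" for r
    using assms(7) by (intro initial_in_words) (auto simp: fractal_tree_def seqs_def)

  define a where "a i = complexity (M k) (initial y i)" for i
  define b where "b r = complexity (M m) (initial x r)" for r
  obtain C1 where C1: "\<And>\<sigma>. \<sigma> \<in> words m \<Longrightarrow>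
      complexity (M k) (transduce (decoder_next T) (decoder_out T k \<tau>) [] \<sigma>) \<le> complexity (M m) \<sigma> + C1"
    using complexity_transduce_le[OF M M transducer_decoder[OF T(1) \<tau>]] describable[OF M] by blast
  obtain C2 where C2: "\<And>ys d. ys \<in> words k \<Longrightarrow> d \<le> L \<Longrightarrow>
      complexity (M m) (take (length (concat (map \<tau> ys)) - d) (concat (map \<tau> ys))) \<le> complexity (M k) ys + C2"
    using complexity_le_complexity_code[of k "M k" m "M m" \<tau> L, OF M M] \<tau>_mem T(3) by blast
  have a_le: "a i \<le> b r + (C1 + C2)" if "n i \<le> r" "r < n (Suc i)" for i r
  proof -
    have seg: "segment x (n i) (n (Suc i)) = segment x (n i) r @ segment x r (n (Suc i))"
      using that by (simp add: segment_append)
    moreover have "segment x r (n (Suc i)) \<noteq> []"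
      using that(2) by (metis length_segment list.size(3) zero_less_diff less_irrefl)
    ultimately have "strict_prefix (segment x (n i) r) (segment x (n i) (n (Suc i)))"
      by (simp add: strict_prefix_def)
    moreover have "initial x r = concat (map \<tau> (initial y i)) @ segment x (n i) r"
      using that(1) by (simp flip: code add: segment_append)
    moreover have "set (initial y i) \<subseteq> {..<k}" using y by (auto simp: segment_def)
    ultimately have "transduce (decoder_next T) (decoder_out T k \<tau>) [] (initial x r) = initial y i"
      using transduce_decoder[OF T(5) \<tau> branching(1) _ cuts(3)[of i]] by simp
    then show ?thesis using C1[OF x_words[of r]] by (simp add: a_def b_def)
  qed
  have b_le: "b r \<le> a i + (C1 + C2)" if "r \<le> n i" "n i \<le> r + L" for i r
  proof -
    have d: "n i - r \<le> L" using that(2) by simp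
    have "take (n i - (n i - r)) (initial x (n i)) = initial x r"
      using that(1) by (simp add: take_segment)
    then show ?thesis
      using C2[OF initial_in_words[of y k i, OF y] d]
      by (simp add: a_def b_def flip: code)
  qed

  define \<alpha> where "\<alpha> = channel_capacity k len"
  define c where "c = log 2 (real m)"
  have len: "\<forall>i<k. len i > 0" using \<tau>_mem branching(1) unfolding assms(5) by (metis length_greater_0_conv)
  have \<alpha>: "\<alpha> > 0" unfolding \<alpha>_def by (rule channel_capacity(1)[OF k len])
  have c: "c > 0" using branching(2) by (simp add: c_def)
  have sdim: "sdim m T = \<alpha> / c"
    using sdim_eq_capacity[OF branching(2) k \<tau> branching(1)] by (simp add: \<alpha>_def c_def assms(5))
  have "- log 2 (cylinder_measure \<mu> (initial y i)) = \<alpha> * real (n i)" for i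
    unfolding assms(6) using cylinder_measure_length_measure[of k len y i, OF k len y]
    by (simp add: \<alpha>_def n_sum)
  then have scale: "ereal (real (a i) / (real (n i) * c)) =
      ereal (sdim m T) * ereal (real (complexity (M k) (initial y i)) /
        - log 2 (cylinder_measure \<mu> (initial y i)))" for i
    using \<alpha> c by (simp add: sdim a_def)
  have pos: "ereal (sdim m T) > 0" using \<alpha> c by (simp add: sdim)
  have limits: "liminf (\<lambda>r. ereal (real (b r) / (real r * c))) = liminf (\<lambda>i. ereal (real (a i) / (real (n i) * c)))"
    "limsup (\<lambda>r. ereal (real (b r) / (real r * c))) = limsup (\<lambda>i. ereal (real (a i) / (real (n i) * c)))"
    by (rule ratio_limits_along_cuts[OF cuts(1,2) gap c a_le b_le]; assumption)+
  have "eff_dim (M m) m x = ereal (sdim m T) * eff_dim_measure (M k) \<mu> y"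
    unfolding eff_dim_def b_def[symmetric] c_def[symmetric] limits(1) scale eff_dim_measure_def
    by (rule ereal_liminf_lim_mult[OF tendsto_const pos]) simp
  moreover have "eff_Dim (M m) m x = ereal (sdim m T) * eff_Dim_measure (M k) \<mu> y"
    unfolding eff_Dim_def b_def[symmetric] c_def[symmetric] limits(2) scale eff_Dim_measure_def
    by (rule ereal_limsup_lim_mult[OF tendsto_const pos]) simp
  ultimately show ?thesis by blast
qed

end
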